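(* Consider rectilinear shock waves with dimensionless parameters $M,M_-,R,\mathcal F=(\mathcal F_{ij})_{i,j=1,2}$ satisfying the Lax conditions $$\sqrt{\mathcal F_{11}^2+\mathcal F_{12}^2}<M<\sqrt{1+\mathcal F_{11}^2+\mathcal F_{12}^2},\qquad M_->\frac{M}{\sqrt{M^2-\mathcal F_{11}^2-\mathcal F_{12}^2}} .$$ In each of the particular cases $\mathcal F_{12}=\mathcal F_{21}=0$ and $\mathcal F_{11}=\mathcal F_{22}=0$ the Lopatinski condition always holds, i.e. all rectilinear shock waves are at least weakly stable. Moreover: (a) if $\mathcal F_{12}=\mathcal F_{21}=0$, the rectilinear shock wave is uniformly stable if and only if $$1+\mathcal F_{11}^2+M^2-R(1+\mathcal F_{11}^2)(M^2-\mathcal F_{11}^2)+\mathcal F_{22}^2M^2>0;$$ (b) if $\mathcal F_{11}=\mathcal F_{22}=0$, the rectilinear shock wave is uniformly stable if and only if $$1+\mathcal F_{12}^2+M^2-R(1+\mathcal F_{12}^2)(M^2-\mathcal F_{12}^2)+\mathcal F_{21}^2M^2>0 .$$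
   Context: **Rectilinear shock wave.** The pressure $p=p(\rho)$ is a smooth function of the density with $p'(\rho)>0$ for $\rho>0$. A rectilinear shock wave (in 2D isentropic compressible elastodynamics, with front $x_1=0$) is a pair of constant states with densities $\hat\rho^\pm>0$, velocities $\hat v^\pm=(\hat v_1^\pm,0)$ with $\hat v_1^\pm>0$, and deformation gradients $\widehat F^\pm=(\widehat F^\pm_{ij})_{i,j=1,2}$, $\det\widehat F^\pm\ne0$ ("$+$" is the state behind the shock, in $x_1>0$, "$-$" the state ahead, in $x_1<0$), with $\hat\rho^+\neq\hat\rho^-$, satisfying $$\frac{\hat\rho^+}{\hat\rho^-}=\frac{\hat v_1^-}{\hat v_1^+},\quad \frac{\hat\rho^+}{\hat\rho^-}\big\{(\hat v_1^+)^2-(\widehat F_{11}^+)^2-(\widehat F_{12}^+)^2\big\}(\hat\rho^+-\hat\rho^-)=p(\hat\rho^+)-p(\hat\rho^-),$$ $$\widehat F_{2j}^+=\widehat F_{2j}^-,\quad \hat\rho^+\widehat F_{1j}^+=\hat\rho^-\widehat F_{1j}^-\quad(j=1,2).$$ Put $\hat c^\pm=\sqrt{p'(\hat\rho^\pm)}$, $M=\hat v_1^+/\hat c^+$, $M_-=\hat v_1^-/\hat c^-$, $R=\hat\rho^+/\hat\rho^-$ (so $R\ne1$), $\mathcal F_{ij}=\widehat F^+_{ij}/\hat c^+$. **Linearized problem.** Let $\mathbb R^2_+=\{x_1>0\}$ and $$M_*=\sqrt{1+\mathcal F_{11}^2+\mathcal F_{12}^2},\ \ \beta=\sqrt{M_*^2-M^2},\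 \ \ell_0=\mathcal F_{11}\mathcal F_{21}+\mathcal F_{12}\mathcal F_{22},\ \ d_0=\frac{M_*^2+M^2}{2M^2},\ \ a_0=-\frac{\beta^2R}{2M^2},\ \ \partial_\star=\partial_t-\frac{\ell_0}{M^2}\partial_2 .$$ For $U=(p,v_1,v_2,F_{11},F_{21},F_{12},F_{22})(t,x)$, with $v=(v_1,v_2)$, $F_1=(F_{11},F_{21})$, $F_2=(F_{12},F_{22})$, $\mathcal F_1=(\mathcal F_{11},\mathcal F_{21})$, $\mathcal F_2=(\mathcal F_{12},\mathcal F_{22})$, $L=\partial_t+\partial_1$, the linearized equations in $\mathbb R^2_+$ are $\mathcal A_0\partial_tU+\mathcal A_1\partial_1U+\mathcal A_2\partial_2U=0$, that is, $$Lp+\mathrm{div}\,v=0,\quad M^2Lv+\nabla p-(\mathcal F_1\cdot\nabla)F_1-(\mathcal F_2\cdot\nabla)F_2=0,\quad LF_1-(\mathcal F_1\cdot\nabla)v=0,\quad LF_2-(\mathcal F_2\cdot\nabla)v=0$$ (this defines the symmetric $7\times7$ matrices $\mathcal A_0=\mathrm{diag}(1,M^2I_2,I_4)$, $\mathcal A_1$, $\mathcal A_2$), and the boundary conditions on $x_1=0$ (the front perturbation being eliminated) are $$v_1+d_0p-\tfrac{\ell_0}{M^2R}v_2=0,\quad \partial_\star v_2-a_0\partial_2p=0,\quad F_{11}+\mathcal F_{11}p-\tfrac{\mathcal F_{21}}Rv_2=0,$$ $$F_{12}+\mathcal F_{12}p-\tfrac{\mathcal F_{22}}Rv_2=0,\quad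 F_{21}-\mathcal F_{11}v_2=0,\quad F_{22}-\mathcal F_{12}v_2=0 .$$ **Lopatinski conditions.** Write $s=\eta+i\xi$. For $\eta>0$ and $(\xi,\omega)\in\mathbb R^2$ the equation $\det(s\mathcal A_0+\lambda\mathcal A_1+i\omega\mathcal A_2)=0$ has a unique root $\lambda=\lambda^+(\eta,\xi,\omega)$ with $\mathrm{Re}\,\lambda>0$; set $\lambda^+(0,\xi,\omega)=\lim_{\eta\to+0}\lambda^+(\eta,\xi,\omega)$. Let $\widetilde U_0=(p,v_1,v_2,F_{11},F_{21},F_{12},F_{22})\in\mathbb C^7$ be the vector (unique up to a nonzero factor) satisfying the six boundary conditions with $\partial_t$, $\partial_2$ replaced by $s$, $i\omega$, that is, the six linear algebraic equations $$v_1+d_0p-\tfrac{\ell_0}{M^2R}v_2=0,\quad \Big(s-\tfrac{i\omega\ell_0}{M^2}\Big)v_2-i\omega a_0p=0,\quad F_{11}+\mathcal F_{11}p-\tfrac{\mathcal F_{21}}Rv_2=0,$$ $$F_{12}+\mathcal F_{12}p-\tfrac{\mathcal F_{22}}Rv_2=0,\quad F_{21}-\mathcal F_{11}v_2=0,\quad F_{22}-\mathcal F_{12}v_2=0 .$$ Let $\mathfrak L(\eta,\xi,\omega,\lambda^+)$ be the $7\times7$ matrix of the linear system for $X\in\mathbb C^7$ consisting of $(\mathcal A_1\widetilde U_0)\cdot X=0$ (bilinear dot product) together with six linearly independent equations of $(s\mathcal A_0+\lambda^+\mathcal A_1+i\omega\mathcal A_2)X=0$. - The Lopatinski condition holds (the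 shock wave is at least weakly stable) if $\det\mathfrak L(\eta,\xi,\omega,\lambda^+)\ne0$ for all $\eta>0$, $(\xi,\omega)\in\mathbb R^2$. - The uniform Lopatinski condition holds (the shock wave is uniformly stable) if $\det\mathfrak L(\eta,\xi,\omega,\lambda^+)\ne0$ for all $\eta\ge0$, $(\xi,\omega)\in\mathbb R^2$ with $\eta^2+\xi^2+\omega^2\ne0$. *)

theory Defs
  imports "HOL-Analysis.Analysis"
begin

section \<open>Rectilinear shock waves\<close>

definition smooth_pressure :: "(real \<Rightarrow> real) \<Rightarrow> bool" where
  "smooth_pressure p \<longleftrightarrow>
     (\<forall>n. (deriv ^^ n) p differentiable_on {0<..}) \<and> (\<forall>\<rho>>0. deriv p \<rho> > 0)"

definition sound_speed :: "(real \<Rightarrow> real) \<Rightarrow> real \<Rightarrow> real" where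
  "sound_speed p \<rho> = sqrt (deriv p \<rho>)"

definition rectilinear_shock ::
    "(real \<Rightarrow> real) \<Rightarrow> real \<Rightarrow> real^2 \<Rightarrow> real^2^2 \<Rightarrow> real \<Rightarrow> real^2 \<Rightarrow> real^2^2 \<Rightarrow> bool" where
  "rectilinear_shock p \<rho>p vp Fp \<rho>m vm Fm \<longleftrightarrow>
     \<rho>p > 0 \<and> \<rho>m > 0 \<and> \<rho>p \<noteq> \<rho>m \<and>
     vp $ 1 > 0 \<and> vm $ 1 > 0 \<and> vp $ 2 = 0 \<and> vm $ 2 = 0 \<and>
     det Fp \<noteq> 0 \<and> det Fm \<noteq> 0 \<and>
     \<rho>p / \<rho>m = vm $ 1 / vp $ 1 \<and>
     \<rho>p / \<rho>m * ((vp $ 1)\<^sup>2 - (Fp $ 1 $ 1)\<^sup>2 - (Fp $ 1 $ 2)\<^sup>2) * (\<rho>p - \<rho>m) = p \<rho>p - p \<rho>m \<and>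
     (\<forall>j. Fp $ 2 $ j = Fm $ 2 $ j) \<and>
     (\<forall>j. \<rho>p * Fp $ 1 $ j = \<rho>m * Fm $ 1 $ j)"

definition lax_conditions :: "real \<Rightarrow> real \<Rightarrow> real^2^2 \<Rightarrow> bool" where
  "lax_conditions M Mm F \<longleftrightarrow>
     sqrt ((F$1$1)\<^sup>2 + (F$1$2)\<^sup>2) < M \<and>
     M < sqrt (1 + (F$1$1)\<^sup>2 + (F$1$2)\<^sup>2) \<and>
     Mm > M / sqrt (M\<^sup>2 - (F$1$1)\<^sup>2 - (F$1$2)\<^sup>2)"

section \<open>The linearized problem\<close>

text \<open>
  \<open>F\<close> is the scaled deformation gradient behind the shock.  The vector of unknowns is indexed as
  \<open>U = (p, v\<^sub>1, v\<^sub>2, F\<^sub>1\<^sub>1, F\<^sub>2\<^sub>1, F\<^sub>1\<^sub>2, F\<^sub>2\<^sub>2)\<close>, so that components 4, 5 form the first column and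
  components 6, 7 the second column of the perturbation of the deformation gradient.
\<close>

definition M_star :: "real^2^2 \<Rightarrow> real" where
  "M_star F = sqrt (1 + (F$1$1)\<^sup>2 + (F$1$2)\<^sup>2)"

definition beta :: "real \<Rightarrow> real^2^2 \<Rightarrow> real" where
  "beta M F = sqrt ((M_star F)\<^sup>2 - M\<^sup>2)"

definition ell0 :: "real^2^2 \<Rightarrow> real" where
  "ell0 F = F$1$1 * F$2$1 + F$1$2 * F$2$2"

definition d0 :: "real \<Rightarrow> real^2^2 \<Rightarrow> real" where
  "d0 M F = ((M_star F)\<^sup>2 + M\<^sup>2) / (2 * M\<^sup>2)"

definition a0 :: "real \<Rightarrow> real \<Rightarrow> real^2^2 \<Rightarrow> real" where
  "a0 M R F = - ((beta M F)\<^sup>2 * R / (2 * M\<^sup>2))"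

definition A0 :: "real \<Rightarrow> real^7^7" where
  "A0 M = vector
    [vector [1, 0, 0, 0, 0, 0, 0],
     vector [0, M\<^sup>2, 0, 0, 0, 0, 0],
     vector [0, 0, M\<^sup>2, 0, 0, 0, 0],
     vector [0, 0, 0, 1, 0, 0, 0],
     vector [0, 0, 0, 0, 1, 0, 0],
     vector [0, 0, 0, 0, 0, 1, 0],
     vector [0, 0, 0, 0, 0, 0, 1]]"

definition A1 :: "real \<Rightarrow> real^2^2 \<Rightarrow> real^7^7" where
  "A1 M F = vector
    [vector [1, 1, 0, 0, 0, 0, 0],
     vector [1, M\<^sup>2, 0, - F$1$1, 0, - F$1$2, 0],
     vector [0, 0, M\<^sup>2, 0, - F$1$1, 0, - F$1$2],
     vector [0, - F$1$1, 0, 1, 0, 0, 0],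
     vector [0, 0, - F$1$1, 0, 1, 0, 0],
     vector [0, - F$1$2, 0, 0, 0, 1, 0],
     vector [0, 0, - F$1$2, 0, 0, 0, 1]]"

definition A2 :: "real^2^2 \<Rightarrow> real^7^7" where
  "A2 F = vector
    [vector [0, 0, 1, 0, 0, 0, 0],
     vector [0, 0, 0, - F$2$1, 0, - F$2$2, 0],
     vector [1, 0, 0, 0, - F$2$1, 0, - F$2$2],
     vector [0, - F$2$1, 0, 0, 0, 0, 0],
     vector [0, 0, - F$2$1, 0, 0, 0, 0],
     vector [0, - F$2$2, 0, 0, 0, 0, 0],
     vector [0, 0, - F$2$2, 0, 0, 0, 0]]"

lemma exhaust_7:
  fixes x :: 7
  shows "x = 1 \<or> x = 2 \<or> x = 3 \<or> x = 4 \<or> x = 5 \<or> x = 6 \<or> x = 7"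
proof (induct x)
  case (of_int z)
  then have "0 \<le> z" and "z < 7" by simp_all
  then have "z = 0 \<or> z = 1 \<or> z = 2 \<or> z = 3 \<or> z = 4 \<or> z = 5 \<or> z = 6" by arith
  then show ?case by auto
qed

lemma UNIV_7: "UNIV = {1::7, 2, 3, 4, 5, 6, 7}"
  using exhaust_7 by auto

lemma forall_7:
  "(\<forall>i::7. P i) \<longleftrightarrow> P 1 \<and> P 2 \<and> P 3 \<and> P 4 \<and> P 5 \<and> P 6 \<and> P 7"
  by (metis exhaust_7)

lemma sum_7: "sum f (UNIV::7 set) = f 1 + f 2 + f 3 + f 4 + f 5 + f 6 + f 7"
  unfolding UNIV_7 by (simp add: algebra_simps)

lemma vector_7:
  "(vector [a,b,c,d,e,f,g] :: 'a::zero^7) $ 1 = a"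
  "(vector [a,b,c,d,e,f,g] :: 'a::zero^7) $ 2 = b"
  "(vector [a,b,c,d,e,f,g] :: 'a::zero^7) $ 3 = c"
  "(vector [a,b,c,d,e,f,g] :: 'a::zero^7) $ 4 = d"
  "(vector [a,b,c,d,e,f,g] :: 'a::zero^7) $ 5 = e"
  "(vector [a,b,c,d,e,f,g] :: 'a::zero^7) $ 6 = f"
  "(vector [a,b,c,d,e,f,g] :: 'a::zero^7) $ 7 = g"
  unfolding vector_def by simp_all

text \<open>
  The matrices encode the linearized equations: \<open>T\<close>, \<open>X\<close>, \<open>Y\<close> stand for the derivatives of \<open>U\<close> with
  respect to \<open>t\<close>, \<open>x\<^sub>1\<close>, \<open>x\<^sub>2\<close>, so that \<open>T + X\<close> is \<open>L U\<close>.
\<close>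

lemma linearized_system:
  "A0 M *v T + A1 M F *v X + A2 F *v Y = 0 \<longleftrightarrow>
     (T$1 + X$1) + X$2 + Y$3 = 0 \<and>
     M\<^sup>2 * (T$2 + X$2) + X$1 - (F$1$1 * X$4 + F$2$1 * Y$4) - (F$1$2 * X$6 + F$2$2 * Y$6) = 0 \<and>
     M\<^sup>2 * (T$3 + X$3) + Y$1 - (F$1$1 * X$5 + F$2$1 * Y$5) - (F$1$2 * X$7 + F$2$2 * Y$7) = 0 \<and>
     (T$4 + X$4) - (F$1$1 * X$2 + F$2$1 * Y$2) = 0 \<and>
     (T$5 + X$5) - (F$1$1 * X$3 + F$2$1 * Y$3) = 0 \<and>
     (T$6 + X$6) - (F$1$2 * X$2 + F$2$2 * Y$2) = 0 \<and>
     (T$7 + X$7) - (F$1$2 * X$3 + F$2$2 * Y$3) = 0"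
  unfolding vec_eq_iff forall_7
  by (simp add: matrix_vector_mult_def sum_7 vector_7 A0_def A1_def A2_def algebra_simps)

section \<open>Lopatinski conditions\<close>

definition system_symbol ::
    "real \<Rightarrow> real^2^2 \<Rightarrow> complex \<Rightarrow> real \<Rightarrow> complex \<Rightarrow> complex^7^7" where
  "system_symbol M F s \<omega> \<mu> =
     (\<chi> i j. s * complex_of_real (A0 M $ i $ j) + \<mu> * complex_of_real (A1 M F $ i $ j)
            + \<i> * complex_of_real \<omega> * complex_of_real (A2 F $ i $ j))"

definition lambda_root :: "real \<Rightarrow> real^2^2 \<Rightarrow> real \<Rightarrow> real \<Rightarrow> real \<Rightarrow> complex" where
  "lambda_root M F \<eta> \<xi> \<omega> = (THE \<mu>. Re \<mu> > 0 \<and> det (system_symbol M F (Complex \<eta> \<xi>) \<omega> \<mu>) = 0)"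

definition lambda_plus :: "real \<Rightarrow> real^2^2 \<Rightarrow> real \<Rightarrow> real \<Rightarrow> real \<Rightarrow> complex" where
  "lambda_plus M F \<eta> \<xi> \<omega> =
     (if \<eta> > 0 then lambda_root M F \<eta> \<xi> \<omega>
      else Lim (at_right 0) (\<lambda>\<eta>'. lambda_root M F \<eta>' \<xi> \<omega>))"

definition boundary_symbol ::
    "real \<Rightarrow> real \<Rightarrow> real^2^2 \<Rightarrow> complex \<Rightarrow> real \<Rightarrow> complex^7 \<Rightarrow> bool" where
  "boundary_symbol M R F s \<omega> U \<longleftrightarrow>
     U$2 + complex_of_real (d0 M F) * U$1 - complex_of_real (ell0 F / (M\<^sup>2 * R)) * U$3 = 0 \<and>
     (s - \<i> * complex_of_real (\<omega> * ell0 F / M\<^sup>2)) * U$3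
       - \<i> * complex_of_real (\<omega> * a0 M R F) * U$1 = 0 \<and>
     U$4 + complex_of_real (F$1$1) * U$1 - complex_of_real (F$2$1 / R) * U$3 = 0 \<and>
     U$6 + complex_of_real (F$1$2) * U$1 - complex_of_real (F$2$2 / R) * U$3 = 0 \<and>
     U$5 - complex_of_real (F$1$1) * U$3 = 0 \<and>
     U$7 - complex_of_real (F$1$2) * U$3 = 0"

text \<open>
  The system has seven rows; six linearly independent ones are singled out by naming the row \<open>k\<close>
  that is dropped, and the equation \<open>(A\<^sub>1 U) \<cdot> X = 0\<close> is written in its place.  Injectivity makes the
  independence that of the family of rows, not just of the set of their values.  Neither \<open>U\<close> (unique
  up to a factor) nor \<open>k\<close> matters for whether the determinant vanishes.
\<close>

definition lopatinski_matrix ::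
    "real \<Rightarrow> real \<Rightarrow> real^2^2 \<Rightarrow> complex \<Rightarrow> real \<Rightarrow> complex \<Rightarrow> complex^7^7 \<Rightarrow> bool" where
  "lopatinski_matrix M R F s \<omega> \<mu> \<LL> \<longleftrightarrow>
     (\<exists>U k. U \<noteq> 0 \<and> boundary_symbol M R F s \<omega> U \<and>
        inj_on (($) (system_symbol M F s \<omega> \<mu>)) (- {k}) \<and>
        vec.independent (($) (system_symbol M F s \<omega> \<mu>) ` (- {k})) \<and>
        \<LL> = (\<chi> i. if i = k then map_matrix complex_of_real (A1 M F) *v U
                   else system_symbol M F s \<omega> \<mu> $ i))"

definition lopatinski_nonzero ::
    "real \<Rightarrow> real \<Rightarrow> real^2^2 \<Rightarrow> real \<Rightarrow> real \<Rightarrow> real \<Rightarrow> bool" where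
  "lopatinski_nonzero M R F \<eta> \<xi> \<omega> \<longleftrightarrow>
     (\<exists>\<LL>. lopatinski_matrix M R F (Complex \<eta> \<xi>) \<omega> (lambda_plus M F \<eta> \<xi> \<omega>) \<LL>) \<and>
     (\<forall>\<LL>. lopatinski_matrix M R F (Complex \<eta> \<xi>) \<omega> (lambda_plus M F \<eta> \<xi> \<omega>) \<LL> \<longrightarrow> det \<LL> \<noteq> 0)"

definition lopatinski_condition :: "real \<Rightarrow> real \<Rightarrow> real^2^2 \<Rightarrow> bool" where
  "lopatinski_condition M R F \<longleftrightarrow> (\<forall>\<eta> \<xi> \<omega>. \<eta> > 0 \<longrightarrow> lopatinski_nonzero M R F \<eta> \<xi> \<omega>)"

definition uniform_lopatinski_condition :: "real \<Rightarrow> real \<Rightarrow> real^2^2 \<Rightarrow> bool" where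
  "uniform_lopatinski_condition M R F \<longleftrightarrow>
     (\<forall>\<eta> \<xi> \<omega>. \<eta> \<ge> 0 \<longrightarrow> \<eta>\<^sup>2 + \<xi>\<^sup>2 + \<omega>\<^sup>2 \<noteq> 0 \<longrightarrow> lopatinski_nonzero M R F \<eta> \<xi> \<omega>)"

end

(* When the rows of F are orthogonal (ell0 = 0), the determinant of the symbol factors and the only
   root in the right half-plane belongs to the acoustic factor: the decay rate is
   mu = (M^2 s + r) / b with b = 1 + A - M^2 and r^2 = M^2 (1 + A) s^2 + b (1 + B) w^2, where A, B are
   the squared lengths of the rows of F.  The symbol is symmetric with a one-dimensional kernel, so
   the Lopatinski determinant vanishes exactly when A1 U is orthogonal to the kernel vector, which
   on the dispersion relation reduces to b mu^2 = w^2 (1 - R (M^2 - A)).  A positive right-hand side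
   forces real mu, hence Re s < 0; a nonpositive one forces imaginary mu, hence Re s = 0.  On the
   imaginary axis |mu| attains precisely the values from M sqrt ((1 + B) / (b (1 + A))) |w| upwards,
   and comparing this bound with the required value gives the criterion. *)

theory Submission
  imports Defs
begin

section \<open>Linear algebra: kernels and row relations of symmetric matrices\<close>

lemma det_eq_0_iff_kernel:
  fixes A :: "'a::field^'n^'n"
  shows "det A = 0 \<longleftrightarrow> (\<exists>x. x \<noteq> 0 \<and> A *v x = 0)"
  using invertible_det_nz[of A] invertible_left_inverse[of A] matrix_left_invertible_ker[of A]
  by blast

text \<open>Independence of an image set does not see repeated vectors; together with injectivity it
  becomes independence of the indexed family, a statement about coefficients alone.\<close>

lemma inj_on_independent_image_iff:
  fixes v :: "'i \<Rightarrow> 'a::field^'n"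
  assumes "finite I"
  shows "inj_on v I \<and> vec.independent (v ` I) \<longleftrightarrow>
    (\<forall>c. (\<Sum>i\<in>I. c i *s v i) = 0 \<longrightarrow> (\<forall>i\<in>I. c i = 0))"
proof
  assume *: "inj_on v I \<and> vec.independent (v ` I)"
  show "\<forall>c. (\<Sum>i\<in>I. c i *s v i) = 0 \<longrightarrow> (\<forall>i\<in>I. c i = 0)"
  proof (intro allI impI)
    fix c assume c: "(\<Sum>i\<in>I. c i *s v i) = 0"
    have "(\<Sum>x\<in>v ` I. c (the_inv_into I v x) *s x) = (\<Sum>i\<in>I. c i *s v i)"
      using * by (simp add: sum.reindex the_inv_into_f_f)
    with c have "(\<Sum>x\<in>v ` I. c (the_inv_into I v x) *s x) = 0" by simp
    moreover have "\<forall>a. (\<Sum>x\<in>v ` I. a x *s x) = 0 \<longrightarrow> (\<forall>x\<in>v ` I. a x = 0)"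
      using * unfolding vec.independent_explicit by simp
    ultimately have "\<forall>x\<in>v ` I. c (the_inv_into I v x) = 0"
      by (elim allE[of _ "\<lambda>x. c (the_inv_into I v x)"]) simp
    with * show "\<forall>i\<in>I. c i = 0"
      by (simp add: the_inv_into_f_f)
  qed
next
  assume *: "\<forall>c. (\<Sum>i\<in>I. c i *s v i) = 0 \<longrightarrow> (\<forall>i\<in>I. c i = 0)"
  have inj: "inj_on v I"
  proof (rule inj_onI, rule ccontr)
    fix i j assume ij: "i \<in> I" "j \<in> I" "v i = v j" "i \<noteq> j"
    \<comment> \<open>Two indices with the same vector admit the relation with coefficients 1 and
      -1.\<close>
    let ?c = "\<lambda>l. if l = i then 1 else if l = j then - 1 else 0 :: 'a"
    have "(\<Sum>l\<in>I. ?c l *s v l) = (\<Sum>l\<in>{i, j}. ?c l *s v l)"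
      using assms ij by (intro sum.mono_neutral_right) auto
    also have "\<dots> = 0"
      using ij by simp
    finally have "\<forall>l\<in>I. ?c l = 0"
      using * by (elim allE[of _ ?c] mp)
    then have "?c i = 0"
      using ij(1) by (rule bspec)
    then show False by simp
  qed
  moreover have "vec.independent (v ` I)"
  proof (rule vec.independent_if_scalars_zero)
    fix f x assume f: "(\<Sum>x\<in>v ` I. f x *s x) = 0" and x: "x \<in> v ` I"
    from f have "(\<Sum>i\<in>I. f (v i) *s v i) = 0"
      using inj by (simp add: sum.reindex)
    with * have "\<forall>i\<in>I. f (v i) = 0"
      by (elim allE[of _ "\<lambda>i. f (v i)"] mp)
    with x show "f x = 0" by blast
  qed (use assms in simp)
  ultimately show "inj_on v I \<and> vec.independent (v ` I)" by blast
qed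

text \<open>Symmetry identifies columns with rows, so kernel vectors are exactly the coefficient
  vectors of row relations.\<close>

lemma symmetric_matrix_mult_vec:
  fixes S :: "'a::comm_semiring_1^'n^'n"
  assumes "transpose S = S"
  shows "S *v y = (\<Sum>i\<in>UNIV. y $ i *s (S $ i))"
proof -
  have "S $ j $ i = S $ i $ j" for i j
    using assms by (metis transpose_def vec_lambda_beta)
  then show ?thesis
    by (simp add: vec_eq_iff matrix_vector_mult_def mult.commute)
qed

text \<open>A symmetric matrix with one-dimensional kernel has the kernel vector as its only row relation.\<close>

lemma independent_remaining_rows_iff:
  fixes S :: "'a::field^'n^'n"
  assumes sym: "transpose S = S"
    and ker: "\<And>y. S *v y = 0 \<longleftrightarrow> (\<exists>t. y = t *s x)" and "x \<noteq> 0"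
  shows "inj_on (($) S) (- {k}) \<and> vec.independent (($) S ` (- {k})) \<longleftrightarrow> x $ k \<noteq> 0"
proof -
  \<comment> \<open>Extended by 0 in place \<open>k\<close>, the coefficients of a relation among
    the other rows form a kernel vector.\<close>
  have relation: "(\<Sum>i\<in>- {k}. c i *s (S $ i)) = 0 \<longleftrightarrow>
      (\<exists>t. (\<chi> i. if i = k then 0 else c i) = t *s x)" for c
  proof -
    have "S *v (\<chi> i. if i = k then 0 else c i)
        = (\<Sum>i\<in>UNIV. (if i = k then 0 else c i) *s (S $ i))"
      by (simp add: symmetric_matrix_mult_vec[OF sym])
    also have "\<dots> = (\<Sum>i\<in>- {k}. c i *s (S $ i))"
      by (intro sum.mono_neutral_cong_right) auto
    finally show ?thesis
      by (simp add: ker flip: ker)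
  qed
  show ?thesis
    unfolding inj_on_independent_image_iff[OF finite] relation
  proof
    assume *: "\<forall>c. (\<exists>t. (\<chi> i. if i = k then 0 else c i) = t *s x) \<longrightarrow> (\<forall>i\<in>- {k}. c i = 0)"
    show "x $ k \<noteq> 0"
    proof
      assume "x $ k = 0"
      then have "(\<chi> i. if i = k then 0 else x $ i) = 1 *s x"
        by (auto simp: vec_eq_iff)
      with * have "\<forall>i\<in>- {k}. x $ i = 0" by blast
      with \<open>x $ k = 0\<close> \<open>x \<noteq> 0\<close> show False
        by (auto simp: vec_eq_iff)
    qed
  next
    assume "x $ k \<noteq> 0"
    then show "\<forall>c. (\<exists>t. (\<chi> i. if i = k then 0 else c i) = t *s x) \<longrightarrow> (\<forall>i\<in>- {k}. c i = 0)"
      by (auto simp: vec_eq_iff) (metis mult_eq_0_iff)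
  qed
qed

text \<open>Symmetry and \<open>S *v x = 0\<close> make the entries of \<open>S *v y\<close>,
  weighted by those of \<open>x\<close>, sum to 0. As \<open>x $ k\<close> is nonzero, the
  \<open>k\<close>-th equation of \<open>S *v y = 0\<close> follows from the others, so the kernel
  of the modified matrix consists of the multiples of \<open>x\<close> that \<open>b\<close>
  annihilates.\<close>

lemma det_replace_row_eq_0_iff:
  fixes S :: "'a::field^'n^'n"
  assumes sym: "transpose S = S"
    and ker: "\<And>y. S *v y = 0 \<longleftrightarrow> (\<exists>t. y = t *s x)" and k: "x $ k \<noteq> 0"
  shows "det (\<chi> i. if i = k then b else S $ i) = 0 \<longleftrightarrow> (\<Sum>i\<in>UNIV. b $ i * x $ i) = 0"
proof -
  let ?L = "\<chi> i. if i = k then b else S $ i"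
  have L: "?L *v y = 0 \<longleftrightarrow>
      (\<Sum>i\<in>UNIV. b $ i * y $ i) = 0 \<and> (\<forall>i. i \<noteq> k \<longrightarrow> (S *v y) $ i = 0)" for y
    by (auto simp: vec_eq_iff matrix_vector_mult_def)
  have "S *v y = 0" if "\<forall>i. i \<noteq> k \<longrightarrow> (S *v y) $ i = 0" for y
  proof -
    have "S *v x = 0"
      using ker[of x] by (metis vector_smult_lid)
    then have "(\<Sum>i\<in>UNIV. x $ i * (S *v y) $ i) = 0"
    proof -
      have "(\<Sum>i\<in>UNIV. x $ i * (S *v y) $ i) = (\<Sum>i\<in>UNIV. \<Sum>j\<in>UNIV. x $ i * (S $ i $ j * y $ j))"
        by (simp add: matrix_vector_mult_def sum_distrib_left)
      also have "\<dots> = (\<Sum>j\<in>UNIV. \<Sum>i\<in>UNIV. x $ i * (S $ i $ j * y $ j))"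
        by (rule sum.swap)
      also have "\<dots> = (\<Sum>j\<in>UNIV. (\<Sum>i\<in>UNIV. x $ i *s (S $ i)) $ j * y $ j)"
        by (simp add: sum_distrib_right mult.assoc)
      also have "\<dots> = 0"
        using \<open>S *v x = 0\<close> by (simp add: symmetric_matrix_mult_vec[OF sym])
      finally show ?thesis .
    qed
    also have "(\<Sum>i\<in>UNIV. x $ i * (S *v y) $ i) = (\<Sum>i\<in>{k}. x $ i * (S *v y) $ i)"
      using that by (intro sum.mono_neutral_right) auto
    finally have "(S *v y) $ k = 0"
      using k by simp
    with that show ?thesis
      by (metis vec_eq_iff zero_index)
  qed
  then have kerL: "?L *v y = 0 \<longleftrightarrow> (\<Sum>i\<in>UNIV. b $ i * y $ i) = 0 \<and> (\<exists>t. y = t *s x)" for y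
    unfolding L ker[symmetric] by auto
  have "det ?L = 0 \<longleftrightarrow> (\<exists>t. t *s x \<noteq> 0 \<and> (\<Sum>i\<in>UNIV. b $ i * (t *s x) $ i) = 0)"
    unfolding det_eq_0_iff_kernel kerL by (iprover elim: subst intro: sym)
  also have "\<dots> \<longleftrightarrow> (\<exists>t. t \<noteq> 0 \<and> t * (\<Sum>i\<in>UNIV. b $ i * x $ i) = 0)"
  proof -
    have "t *s x \<noteq> 0 \<longleftrightarrow> t \<noteq> 0" for t
      using k by (auto simp: vec_eq_iff)
    moreover have "(\<Sum>i\<in>UNIV. b $ i * (t *s x) $ i) = t * (\<Sum>i\<in>UNIV. b $ i * x $ i)" for t
      by (simp add: sum_distrib_left mult.left_commute)
    ultimately show ?thesis by simp
  qed
  also have "\<dots> \<longleftrightarrow> (\<Sum>i\<in>UNIV. b $ i * x $ i) = 0"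
    by (auto intro: exI[of _ "1::'a"])
  finally show ?thesis .
qed

section \<open>Square roots on the closed right half-plane\<close>

text \<open>The closed half-plane meets the branch cut only at 0, where the modulus of the root
  tends to 0.\<close>

lemma continuous_within_csqrt_right_half_plane:
  assumes "Re z \<ge> 0"
  shows "continuous (at z within S) csqrt"
proof (cases "z = 0")
  case True
  have "((\<lambda>w. csqrt w) \<longlongrightarrow> 0) (at 0)"
    by (rule tendsto_norm_zero_cancel) (auto intro!: tendsto_eq_intros)
  with True show ?thesis
    by (auto simp: continuous_within intro: tendsto_within_subset)
next
  case False
  with assms have "z \<notin> \<real>\<^sub>\<le>\<^sub>0"
    by (auto simp: complex_nonpos_Reals_iff complex_eq_iff)
  then show ?thesis
    by (rule continuous_within_csqrt)
qed

text \<open>The root lies in the sector of half-angle \<pi>/4 around the positive axis, so a product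
  of two such roots has nonnegative real part.\<close>

lemma abs_Im_csqrt_le_Re_csqrt:
  assumes "Re z \<ge> 0"
  shows "\<bar>Im (csqrt z)\<bar> \<le> Re (csqrt z)"
proof -
  have "(Re (csqrt z))\<^sup>2 - (Im (csqrt z))\<^sup>2 = Re ((csqrt z)\<^sup>2)"
    by (simp only: Re_power2)
  with assms have "(Im (csqrt z))\<^sup>2 \<le> (Re (csqrt z))\<^sup>2"
    by (simp del: csqrt.sel)
  then show ?thesis
    using Re_csqrt[of z] by (simp only: abs_le_square_iff[symmetric] abs_of_nonneg)
qed

text \<open>The imaginary parts of the squares agree, so a smaller real part of \<open>r\<close>
  would need an imaginary part at least as large in modulus; then the real part of
  \<open>r\<^sup>2\<close> would be below that of \<open>z\<^sup>2\<close>, against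
  \<open>c \<ge> 0\<close>. This serves both to discard the second acoustic root and to keep the
  elastic factor from vanishing.\<close>

lemma Re_ge_if_square_eq_add_real:
  fixes r z :: complex and c :: real
  assumes "r\<^sup>2 = z\<^sup>2 + of_real c" "c \<ge> 0" "Re z \<ge> 0" "Re r \<ge> 0"
  shows "Re r \<ge> Re z"
proof (rule ccontr)
  assume less: "\<not> Re r \<ge> Re z"
  have re: "(Re r)\<^sup>2 - (Im r)\<^sup>2 = (Re z)\<^sup>2 - (Im z)\<^sup>2 + c" and im: "Re r * Im r = Re z * Im z"
    using arg_cong[OF assms(1), of Re] arg_cong[OF assms(1), of Im]
    by (simp_all add: Re_power2 Im_power2)
  have "(Re r)\<^sup>2 < (Re z)\<^sup>2"
    using less assms by (intro power_strict_mono) auto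
  moreover have "(Re z)\<^sup>2 * (Im z)\<^sup>2 \<le> (Re z)\<^sup>2 * (Im r)\<^sup>2"
  proof -
    have "(Re z)\<^sup>2 * (Im z)\<^sup>2 = (Re r)\<^sup>2 * (Im r)\<^sup>2"
      using im by (metis power_mult_distrib)
    with \<open>(Re r)\<^sup>2 < (Re z)\<^sup>2\<close> show ?thesis
      by (simp add: mult_right_mono)
  qed
  moreover have "(Re z)\<^sup>2 > 0"
    using less assms by auto
  ultimately show False
    using re \<open>c \<ge> 0\<close> by simp
qed

section \<open>The symbol for orthogonal rows and its kernel\<close>

text \<open>
  Both particular cases make the rows of \<open>F\<close> orthogonal; then the stability analysis depends on \<open>F\<close>
  only through the squared lengths \<open>A\<close>, \<open>B\<close> of the rows.
\<close>

locale orthogonal_shock =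
  fixes M R :: real and F :: "real^2^2" and A B :: real
  assumes M_pos: "M > 0" and R_pos: "R > 0"
    and A_def: "A = (F$1$1)\<^sup>2 + (F$1$2)\<^sup>2" and B_def: "B = (F$2$1)\<^sup>2 + (F$2$2)\<^sup>2"
    and A_less: "A < M\<^sup>2" and less_A: "M\<^sup>2 < 1 + A"
    and ell0_eq_0: "ell0 F = 0"
begin

text \<open>Symbol of the shear wave operator, \<open>M\<^sup>2\<close> times the square of L minus
  the squares of the derivatives along the two columns of \<open>F\<close>, with \<open>s\<close>,
  \<open>\<mu>\<close>, \<open>\<i> * \<omega>\<close> for the derivatives in t, x1, x2. The mixed
  term is absent because its coefficient is a multiple of \<open>ell0 F\<close>.\<close>

definition elastic_factor :: "complex \<Rightarrow> real \<Rightarrow> complex \<Rightarrow> complex" where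
  "elastic_factor s \<omega> \<mu> = (of_real M)\<^sup>2 * (s + \<mu>)\<^sup>2 - of_real A * \<mu>\<^sup>2 + (of_real \<omega>)\<^sup>2 * of_real B"

text \<open>Subtracting the symbol of the Laplacian gives the wave operator that governs the
  pressure.\<close>

definition acoustic_factor :: "complex \<Rightarrow> real \<Rightarrow> complex \<Rightarrow> complex" where
  "acoustic_factor s \<omega> \<mu> = elastic_factor s \<omega> \<mu> - (\<mu>\<^sup>2 - (of_real \<omega>)\<^sup>2)"

text \<open>Plane wave derived from a scalar potential: the velocity is minus L of its gradient,
  each column of the deformation is minus the directional derivative of that gradient, and the
  pressure is the shear operator applied to it. This normalization needs no division by
  \<open>s + \<mu>\<close>.\<close>

definition mode :: "complex \<Rightarrow> real \<Rightarrow> complex \<Rightarrow> complex^7" where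
  "mode s \<omega> \<mu> = vector
     [elastic_factor s \<omega> \<mu>, - (s + \<mu>) * \<mu>, - (s + \<mu>) * (\<i> * of_real \<omega>),
      - (of_real (F$1$1) * \<mu> + of_real (F$2$1) * (\<i> * of_real \<omega>)) * \<mu>,
      - (of_real (F$1$1) * \<mu> + of_real (F$2$1) * (\<i> * of_real \<omega>)) * (\<i> * of_real \<omega>),
      - (of_real (F$1$2) * \<mu> + of_real (F$2$2) * (\<i> * of_real \<omega>)) * \<mu>,
      - (of_real (F$1$2) * \<mu> + of_real (F$2$2) * (\<i> * of_real \<omega>)) * (\<i> * of_real \<omega>)]"

lemma A_nonneg: "A \<ge> 0" and B_nonneg: "B \<ge> 0"
  by (simp_all add: A_def B_def)

lemma elastic_factor_alt:
  "elastic_factor s \<omega> \<mu> = (of_real M)\<^sup>2 * (s + \<mu>)\<^sup>2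
     - (of_real (F$1$1) * \<mu> + of_real (F$2$1) * (\<i> * of_real \<omega>))\<^sup>2
     - (of_real (F$1$2) * \<mu> + of_real (F$2$2) * (\<i> * of_real \<omega>))\<^sup>2"
proof -
  have "complex_of_real (F$1$1) * of_real (F$2$1) + of_real (F$1$2) * of_real (F$2$2) = 0"
    using ell0_eq_0 unfolding ell0_def by (metis of_real_0 of_real_add of_real_mult)
  moreover have "\<i>\<^sup>2 = -1" by simp
  moreover have "complex_of_real A = (of_real (F$1$1))\<^sup>2 + (of_real (F$1$2))\<^sup>2"
    "complex_of_real B = (of_real (F$2$1))\<^sup>2 + (of_real (F$2$2))\<^sup>2"
    by (simp_all add: A_def B_def)
  ultimately show ?thesis
    unfolding elastic_factor_def by algebra
qed

lemma transpose_system_symbol: "transpose (system_symbol M F s \<omega> \<mu>) = system_symbol M F s \<omega> \<mu>"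
  unfolding transpose_def system_symbol_def vec_eq_iff forall_7
  by (simp add: vector_7 A0_def A1_def A2_def)

lemma system_symbol_mult_eq_0_iff:
  "system_symbol M F s \<omega> \<mu> *v Y = 0 \<longleftrightarrow>
     (s + \<mu>) * Y$1 + \<mu> * Y$2 + \<i> * of_real \<omega> * Y$3 = 0 \<and>
     (of_real M)\<^sup>2 * (s + \<mu>) * Y$2 + \<mu> * Y$1
       - (of_real (F$1$1) * \<mu> + of_real (F$2$1) * (\<i> * of_real \<omega>)) * Y$4
       - (of_real (F$1$2) * \<mu> + of_real (F$2$2) * (\<i> * of_real \<omega>)) * Y$6 = 0 \<and>
     (of_real M)\<^sup>2 * (s + \<mu>) * Y$3 + \<i> * of_real \<omega> * Y$1
       - (of_real (F$1$1) * \<mu> + of_real (F$2$1) * (\<i> * of_real \<omega>)) * Y$5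
       - (of_real (F$1$2) * \<mu> + of_real (F$2$2) * (\<i> * of_real \<omega>)) * Y$7 = 0 \<and>
     (s + \<mu>) * Y$4 = (of_real (F$1$1) * \<mu> + of_real (F$2$1) * (\<i> * of_real \<omega>)) * Y$2 \<and>
     (s + \<mu>) * Y$5 = (of_real (F$1$1) * \<mu> + of_real (F$2$1) * (\<i> * of_real \<omega>)) * Y$3 \<and>
     (s + \<mu>) * Y$6 = (of_real (F$1$2) * \<mu> + of_real (F$2$2) * (\<i> * of_real \<omega>)) * Y$2 \<and>
     (s + \<mu>) * Y$7 = (of_real (F$1$2) * \<mu> + of_real (F$2$2) * (\<i> * of_real \<omega>)) * Y$3"
  unfolding vec_eq_iff forall_7
  by (simp add: matrix_vector_mult_def sum_7 vector_7 system_symbol_def A0_def A1_def A2_def algebra_simps)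

text \<open>The last four equations eliminate the deformation from the momentum equations, which
  then express the velocity through the pressure; the continuity equation leaves a multiple of the
  pressure alone. Everything stays multiplied by the elastic factor, and only
  \<open>s + \<mu>\<close> is cancelled.\<close>

lemma system_symbol_kernelD:
  assumes ker: "system_symbol M F s \<omega> \<mu> *v Y = 0" and nz: "s + \<mu> \<noteq> 0"
  shows "elastic_factor s \<omega> \<mu> *s Y = Y $ 1 *s mode s \<omega> \<mu>" "acoustic_factor s \<omega> \<mu> * Y $ 1 = 0"
proof -
  define a f g where "a = s + \<mu>"
    and "f = of_real (F$1$1) * \<mu> + of_real (F$2$1) * (\<i> * of_real \<omega>)"
    and "g = of_real (F$1$2) * \<mu> + of_real (F$2$2) * (\<i> * of_real \<omega>)"
  have "a \<noteq> 0" using nz by (simp add: a_def)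
  have Q: "elastic_factor s \<omega> \<mu> = (of_real M)\<^sup>2 * a\<^sup>2 - f\<^sup>2 - g\<^sup>2"
    unfolding elastic_factor_alt a_def f_def g_def ..
  note e = ker[unfolded system_symbol_mult_eq_0_iff, folded a_def, folded f_def, folded g_def]
  have v1: "elastic_factor s \<omega> \<mu> * Y$2 = - a * \<mu> * Y$1"
    and v2: "elastic_factor s \<omega> \<mu> * Y$3 = - a * (\<i> * of_real \<omega>) * Y$1"
    using e unfolding Q by algebra+
  have "a * (elastic_factor s \<omega> \<mu> * Y$4) = a * (- f * \<mu> * Y$1)"
       "a * (elastic_factor s \<omega> \<mu> * Y$5) = a * (- f * (\<i> * of_real \<omega>) * Y$1)"
       "a * (elastic_factor s \<omega> \<mu> * Y$6) = a * (- g * \<mu> * Y$1)"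
       "a * (elastic_factor s \<omega> \<mu> * Y$7) = a * (- g * (\<i> * of_real \<omega>) * Y$1)"
    using e v1 v2 by algebra+
  with \<open>a \<noteq> 0\<close> have
       "elastic_factor s \<omega> \<mu> * Y$4 = - f * \<mu> * Y$1"
       "elastic_factor s \<omega> \<mu> * Y$5 = - f * (\<i> * of_real \<omega>) * Y$1"
       "elastic_factor s \<omega> \<mu> * Y$6 = - g * \<mu> * Y$1"
       "elastic_factor s \<omega> \<mu> * Y$7 = - g * (\<i> * of_real \<omega>) * Y$1"
    unfolding mult_cancel_left by blast+
  moreover have "mode s \<omega> \<mu> = vector [elastic_factor s \<omega> \<mu>, - a * \<mu>, - a * (\<i> * of_real \<omega>),
      - f * \<mu>, - f * (\<i> * of_real \<omega>), - g * \<mu>, - g * (\<i> * of_real \<omega>)]"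
    by (simp only: mode_def a_def f_def g_def)
  ultimately show "elastic_factor s \<omega> \<mu> *s Y = Y $ 1 *s mode s \<omega> \<mu>"
    using v1 v2 unfolding vec_eq_iff forall_7
    by (simp add: vector_7 mult_ac)
  have "a * (acoustic_factor s \<omega> \<mu> * Y$1) = 0"
  proof -
    have "\<i>\<^sup>2 = -1" by simp
    then show ?thesis
      unfolding acoustic_factor_def using e v1 v2 by algebra
  qed
  with \<open>a \<noteq> 0\<close> show "acoustic_factor s \<omega> \<mu> * Y $ 1 = 0" by simp
qed

text \<open>The continuity equation for \<open>mode\<close> is \<open>s + \<mu>\<close> times the
  acoustic factor; the other six equations hold by the choice of its entries.\<close>

lemma system_symbol_mode:
  assumes "acoustic_factor s \<omega> \<mu> = 0"
  shows "system_symbol M F s \<omega> \<mu> *v mode s \<omega> \<mu> = 0"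
proof -
  have "\<i>\<^sup>2 = -1" by simp
  moreover have "elastic_factor s \<omega> \<mu> = \<mu>\<^sup>2 - (of_real \<omega>)\<^sup>2"
    using assms by (simp add: acoustic_factor_def)
  ultimately show ?thesis
    using elastic_factor_alt[of s \<omega> \<mu>]
    unfolding system_symbol_mult_eq_0_iff mode_def vector_7
    by algebra
qed

lemma system_symbol_kernel_iff:
  assumes "s + \<mu> \<noteq> 0" "elastic_factor s \<omega> \<mu> \<noteq> 0" "acoustic_factor s \<omega> \<mu> = 0"
  shows "system_symbol M F s \<omega> \<mu> *v Y = 0 \<longleftrightarrow> (\<exists>t. Y = t *s mode s \<omega> \<mu>)"
proof
  assume "system_symbol M F s \<omega> \<mu> *v Y = 0"
  from system_symbol_kernelD(1)[OF this assms(1)]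
  have "elastic_factor s \<omega> \<mu> * Y $ i = Y $ 1 * mode s \<omega> \<mu> $ i" for i
    by (metis vector_smult_component)
  then have "Y = (Y $ 1 / elastic_factor s \<omega> \<mu>) *s mode s \<omega> \<mu>"
    using assms(2) by (simp add: vec_eq_iff field_simps)
  then show "\<exists>t. Y = t *s mode s \<omega> \<mu>" ..
next
  assume "\<exists>t. Y = t *s mode s \<omega> \<mu>"
  then show "system_symbol M F s \<omega> \<mu> *v Y = 0"
    using system_symbol_mode[OF assms(3)] by (auto simp: vec.scale)
qed

lemma det_system_symbol_eq_0_iff:
  assumes "s + \<mu> \<noteq> 0" "elastic_factor s \<omega> \<mu> \<noteq> 0"
  shows "det (system_symbol M F s \<omega> \<mu>) = 0 \<longleftrightarrow> acoustic_factor s \<omega> \<mu> = 0"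
proof
  assume "det (system_symbol M F s \<omega> \<mu>) = 0"
  then obtain Y where Y: "Y \<noteq> 0" "system_symbol M F s \<omega> \<mu> *v Y = 0"
    unfolding det_eq_0_iff_kernel by blast
  note D = system_symbol_kernelD[OF Y(2) assms(1)]
  have "Y $ 1 \<noteq> 0"
  proof
    assume "Y $ 1 = 0"
    with D(1) have "elastic_factor s \<omega> \<mu> *s Y = 0" by simp
    with Y(1) assms(2) show False by simp
  qed
  with D(2) show "acoustic_factor s \<omega> \<mu> = 0" by simp
next
  assume "acoustic_factor s \<omega> \<mu> = 0"
  moreover have "mode s \<omega> \<mu> \<noteq> 0"
    using assms(2) by (auto simp: vec_eq_iff mode_def vector_7 intro!: exI[of _ 1])
  ultimately show "det (system_symbol M F s \<omega> \<mu>) = 0"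
    unfolding det_eq_0_iff_kernel using system_symbol_mode by blast
qed

section \<open>The root in the right half-plane and its limit on the imaginary axis\<close>

lemma A_less_less: "0 < 1 + A - M\<^sup>2" and A_pos: "0 < M\<^sup>2 - A" "0 < 1 + A"
  using less_A A_less A_nonneg by simp_all

lemma of_real_coefficient_nonzero: "complex_of_real (1 + A - M\<^sup>2) \<noteq> 0"
  unfolding of_real_eq_0_iff using A_less_less by simp

text \<open>
  A square root of \<open>M\<^sup>2 (1 + A) s\<^sup>2 + (1 + A - M\<^sup>2) (1 + B) \<omega>\<^sup>2\<close>.  Taking the root factorwise makes it
  continuous on the closed right half-plane, although the radicand itself reaches the branch cut
  there.
\<close>

definition radical :: "complex \<Rightarrow> real \<Rightarrow> complex" where
  "radical s \<omega> =
     csqrt (of_real (M * sqrt (1 + A)) * s + \<i> * of_real (sqrt ((1 + A - M\<^sup>2) * (1 + B)) * \<omega>)) *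
     csqrt (of_real (M * sqrt (1 + A)) * s - \<i> * of_real (sqrt ((1 + A - M\<^sup>2) * (1 + B)) * \<omega>))"

text \<open>The root of the quadratic acoustic factor that takes the plus sign before the
  radical.\<close>

definition decay_rate :: "complex \<Rightarrow> real \<Rightarrow> complex" where
  "decay_rate s \<omega> = (of_real (M\<^sup>2) * s + radical s \<omega>) / of_real (1 + A - M\<^sup>2)"

lemma decay_rate_eq: "of_real (1 + A - M\<^sup>2) * decay_rate s \<omega> = of_real (M\<^sup>2) * s + radical s \<omega>"
  using of_real_coefficient_nonzero
  by (simp add: decay_rate_def del: of_real_add of_real_diff of_real_power)

lemma radical_square:
  "(radical s \<omega>)\<^sup>2 = (of_real (M * sqrt (1 + A)) * s)\<^sup>2 + of_real ((1 + A - M\<^sup>2) * (1 + B) * \<omega>\<^sup>2)"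
proof -
  define n k where "n = complex_of_real (M * sqrt (1 + A)) * s"
    and "k = sqrt ((1 + A - M\<^sup>2) * (1 + B)) * \<omega>"
  have "(radical s \<omega>)\<^sup>2 = (n + \<i> * of_real k) * (n - \<i> * of_real k)"
    by (simp only: radical_def power_mult_distrib power2_csqrt n_def k_def)
  also have "\<dots> = n\<^sup>2 + of_real (k\<^sup>2)"
    by (simp add: algebra_simps power2_eq_square)
  also have "k\<^sup>2 = (1 + A - M\<^sup>2) * (1 + B) * \<omega>\<^sup>2"
    using A_less_less B_nonneg by (simp add: k_def power_mult_distrib)
  finally show ?thesis by (simp only: n_def)
qed

lemma csqrt_argument_nonneg:
  assumes "Re s \<ge> 0"
  shows "Re (of_real (M * sqrt (1 + A)) * s + \<i> * of_real k) \<ge> 0"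
    "Re (of_real (M * sqrt (1 + A)) * s - \<i> * of_real k) \<ge> 0"
  using assms M_pos A_nonneg by simp_all

text \<open>Both factors of the radical lie in the sector of half-angle \<pi>/4.\<close>

lemma Re_radical_nonneg:
  assumes "Re s \<ge> 0"
  shows "Re (radical s \<omega>) \<ge> 0"
proof -
  define z w where "z = csqrt (of_real (M * sqrt (1 + A)) * s + \<i> * of_real (sqrt ((1 + A - M\<^sup>2) * (1 + B)) * \<omega>))"
    and "w = csqrt (of_real (M * sqrt (1 + A)) * s - \<i> * of_real (sqrt ((1 + A - M\<^sup>2) * (1 + B)) * \<omega>))"
  have "\<bar>Im z\<bar> \<le> Re z" "\<bar>Im w\<bar> \<le> Re w"
    unfolding z_def w_def
    by (intro abs_Im_csqrt_le_Re_csqrt csqrt_argument_nonneg assms)+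
  then have "\<bar>Im z\<bar> * \<bar>Im w\<bar> \<le> Re z * Re w"
    by (intro mult_mono) auto
  then show ?thesis
    unfolding radical_def z_def[symmetric] w_def[symmetric]
    by (simp add: abs_mult[symmetric])
qed

text \<open>This fixes the sign of the radical where it is purely imaginary and the real part cannot
  decide. If the real part is positive, it suffices to compare imaginary parts in
  \<open>radical_square\<close>; otherwise the two factors of the radical have to be
  inspected.\<close>

lemma Im_radical_mult_Im_nonneg:
  assumes "Re s \<ge> 0"
  shows "Im (radical s \<omega>) * Im s \<ge> 0"
proof -
  define n where "n = M * sqrt (1 + A)"
  have "n > 0" using M_pos A_pos by (simp add: n_def)
  define z w where "z = csqrt (of_real n * s + \<i> * of_real (sqrt ((1 + A - M\<^sup>2) * (1 + B)) * \<omega>))"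
    and "w = csqrt (of_real n * s - \<i> * of_real (sqrt ((1 + A - M\<^sup>2) * (1 + B)) * \<omega>))"
  have le: "\<bar>Im z\<bar> \<le> Re z" "\<bar>Im w\<bar> \<le> Re w"
    unfolding z_def w_def n_def
    by (intro abs_Im_csqrt_le_Re_csqrt csqrt_argument_nonneg assms)+
  have rad: "radical s \<omega> = z * w"
    by (simp only: radical_def z_def w_def n_def)
  \<comment> \<open>In the sum of the two arguments the terms with \<omega> cancel, which ties
    \<open>Im s\<close> to the factors.\<close>
  have "z\<^sup>2 + w\<^sup>2 = 2 * of_real n * s"
    by (simp add: z_def w_def)
  from arg_cong[OF this, of Im] have im: "Re z * Im z + Re w * Im w = n * Im s"
    by (simp add: Im_power2)
  show ?thesis
  proof (cases "Re (radical s \<omega>) = 0")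
    case True
    then have eq: "Re z * Re w = Im z * Im w"
      by (simp add: rad)
    have "n * (Im (radical s \<omega>) * Im s) = Im (z * w) * (Re z * Im z + Re w * Im w)"
      unfolding im rad by simp
    also have "\<dots> = Im z * Im w * ((Re z)\<^sup>2 + (Re w)\<^sup>2) + Re z * Re w * ((Im z)\<^sup>2 + (Im w)\<^sup>2)"
      by (simp add: algebra_simps power2_eq_square)
    also have "\<dots> = Re z * Re w * ((Re z)\<^sup>2 + (Re w)\<^sup>2 + (Im z)\<^sup>2 + (Im w)\<^sup>2)"
      unfolding eq[symmetric] by (simp add: algebra_simps)
    also have "\<dots> \<ge> 0"
      using le by (intro mult_nonneg_nonneg add_nonneg_nonneg) auto
    finally show ?thesis
      using \<open>n > 0\<close> by (simp add: zero_le_mult_iff)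
  next
    case False
    with Re_radical_nonneg[OF assms, of \<omega>] have pos: "Re (radical s \<omega>) > 0" by simp
    have "Re (radical s \<omega>) * Im (radical s \<omega>) = n\<^sup>2 * (Re s * Im s)"
      using arg_cong[OF radical_square[of s \<omega>], of Im, folded n_def]
      by (simp add: Im_power2 power_mult_distrib power2_eq_square algebra_simps)
    then have "Re (radical s \<omega>) * (Im (radical s \<omega>) * Im s) = n\<^sup>2 * (Re s * (Im s)\<^sup>2)"
      by (metis mult.assoc power2_eq_square)
    also have "\<dots> \<ge> 0" using assms by simp
    finally show ?thesis
      using pos by (simp add: zero_le_mult_iff)
  qed
qed

lemma continuous_on_decay_rate: "continuous_on {s. Re s \<ge> 0} (\<lambda>s. decay_rate s \<omega>)"
proof -
  have csqrt: "continuous_on {z. Re z \<ge> 0} csqrt"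
    by (auto simp: continuous_on_eq_continuous_within intro: continuous_within_csqrt_right_half_plane)
  show ?thesis
    unfolding decay_rate_def radical_def
    by (intro continuous_intros continuous_on_compose2[OF csqrt])
      (use csqrt_argument_nonneg of_real_coefficient_nonzero in auto)
qed

text \<open>Completing the square in \<mu>, after multiplication by minus the nonzero leading
  coefficient \<open>1 + A - M\<^sup>2\<close>.\<close>

lemma acoustic_factor_eq_0_iff:
  "acoustic_factor s \<omega> \<mu> = 0 \<longleftrightarrow> (of_real (1 + A - M\<^sup>2) * \<mu> - of_real (M\<^sup>2) * s)\<^sup>2 = (radical s \<omega>)\<^sup>2"
proof -
  have "(complex_of_real (M * sqrt (1 + A)) * s)\<^sup>2 = (of_real M)\<^sup>2 * (1 + of_real A) * s\<^sup>2"
    using A_nonneg by (simp add: power_mult_distrib flip: of_real_power)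
  then have "(of_real (1 + A - M\<^sup>2) * \<mu> - of_real (M\<^sup>2) * s)\<^sup>2 - (radical s \<omega>)\<^sup>2
      = - (of_real (1 + A - M\<^sup>2) * acoustic_factor s \<omega> \<mu>)"
    unfolding radical_square acoustic_factor_def elastic_factor_def
    by (simp add: power2_eq_square algebra_simps)
  with of_real_coefficient_nonzero show ?thesis
    by (metis eq_iff_diff_eq_0 mult_eq_0_iff neg_equal_0_iff_equal)
qed

lemma acoustic_factor_decay_rate: "acoustic_factor s \<omega> (decay_rate s \<omega>) = 0"
  unfolding acoustic_factor_eq_0_iff decay_rate_eq by simp

lemma Re_decay_rate:
  "(1 + A - M\<^sup>2) * Re (decay_rate s \<omega>) = M\<^sup>2 * Re s + Re (radical s \<omega>)"
  using arg_cong[OF decay_rate_eq[of s \<omega>], of Re]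
  by (simp del: of_real_add of_real_diff of_real_power)

lemma Im_decay_rate:
  "(1 + A - M\<^sup>2) * Im (decay_rate s \<omega>) = M\<^sup>2 * Im s + Im (radical s \<omega>)"
  using arg_cong[OF decay_rate_eq[of s \<omega>], of Im]
  by (simp del: of_real_add of_real_diff of_real_power)

lemma Re_decay_rate_nonneg:
  assumes "Re s \<ge> 0" shows "Re (decay_rate s \<omega>) \<ge> 0"
  using Re_decay_rate[of s \<omega>] Re_radical_nonneg[OF assms, of \<omega>] assms A_less_less
  by (metis add_nonneg_nonneg less_not_sym mult_nonneg_nonneg zero_le_mult_iff zero_le_power2 not_less)

lemma Re_decay_rate_pos:
  assumes "Re s > 0" shows "Re (decay_rate s \<omega>) > 0"
proof -
  have "M\<^sup>2 * Re s + Re (radical s \<omega>) > 0"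
    using Re_radical_nonneg[of s \<omega>] assms M_pos by (simp add: add_pos_nonneg)
  then show ?thesis
    using A_less_less unfolding Re_decay_rate[symmetric] by (simp add: zero_less_mult_iff)
qed

text \<open>With the minus sign, \<open>1 + A - M\<^sup>2\<close> times the real part of the root is
  \<open>M\<^sup>2 * Re s - Re (radical s \<omega>)\<close>. The radical has real part at least
  \<open>M * sqrt (1 + A) * Re s\<close>, and \<open>M\<^sup>2 < 1 + A\<close>, so that root is not
  in the right half-plane.\<close>

lemma acoustic_root_unique:
  assumes "Re s > 0" "Re \<mu> > 0"
  shows "acoustic_factor s \<omega> \<mu> = 0 \<longleftrightarrow> \<mu> = decay_rate s \<omega>"
proof
  assume "acoustic_factor s \<omega> \<mu> = 0"
  then consider "of_real (1 + A - M\<^sup>2) * \<mu> - of_real (M\<^sup>2) * s = radical s \<omega>"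
    | "of_real (1 + A - M\<^sup>2) * \<mu> - of_real (M\<^sup>2) * s = - radical s \<omega>"
    unfolding acoustic_factor_eq_0_iff power2_eq_iff by blast
  then show "\<mu> = decay_rate s \<omega>"
  proof cases
    case 1
    then have "of_real (1 + A - M\<^sup>2) * \<mu> = of_real (1 + A - M\<^sup>2) * decay_rate s \<omega>"
      unfolding decay_rate_eq by (simp add: algebra_simps)
    with of_real_coefficient_nonzero show ?thesis
      unfolding mult_cancel_left by blast
  next
    case 2
    have "(1 + A - M\<^sup>2) * Re \<mu> = M\<^sup>2 * Re s - Re (radical s \<omega>)"
      using arg_cong[OF 2, of Re] by (simp del: of_real_add of_real_diff of_real_power)
    moreover have "(1 + A - M\<^sup>2) * Re \<mu> > 0"
      using A_less_less assms by simp
    moreover have "Re (radical s \<omega>) \<ge> M * sqrt (1 + A) * Re s"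
      using Re_ge_if_square_eq_add_real[OF radical_square] A_less_less B_nonneg A_pos M_pos assms
        Re_radical_nonneg[of s \<omega>] by simp
    moreover have "M * sqrt (1 + A) \<ge> M\<^sup>2"
      using M_pos less_A by (simp add: power2_eq_square real_le_rsqrt)
    then have "M * sqrt (1 + A) * Re s \<ge> M\<^sup>2 * Re s"
      using assms by (intro mult_right_mono) auto
    ultimately show ?thesis by simp
  qed
qed (simp add: acoustic_factor_decay_rate)

text \<open>A zero would make the square of \<open>sqrt A * \<mu>\<close> equal to that of
  \<open>M * (s + \<mu>)\<close> plus a nonnegative number; comparing real parts contradicts
  \<open>sqrt A < M\<close>.\<close>

lemma elastic_factor_nonzero:
  assumes "Re s > 0" "Re \<mu> > 0"
  shows "elastic_factor s \<omega> \<mu> \<noteq> 0"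
proof
  assume "elastic_factor s \<omega> \<mu> = 0"
  moreover have "(complex_of_real (sqrt A))\<^sup>2 = of_real A"
    using A_nonneg by (simp flip: of_real_power)
  ultimately have "(of_real (sqrt A) * \<mu>)\<^sup>2 = (of_real M * (s + \<mu>))\<^sup>2 + of_real (\<omega>\<^sup>2 * B)"
    unfolding elastic_factor_def of_real_mult of_real_power by algebra
  from Re_ge_if_square_eq_add_real[OF this]
  have "M * (Re s + Re \<mu>) \<le> sqrt A * Re \<mu>"
    using assms M_pos A_nonneg B_nonneg by simp
  moreover have "sqrt A < M"
    using A_less M_pos by (simp add: real_less_lsqrt)
  then have "sqrt A * Re \<mu> < M * Re \<mu>"
    using assms by simp
  moreover have "M * Re s > 0" using assms M_pos by simp
  ultimately show False by (simp add: algebra_simps)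
qed

lemma lambda_root_eq:
  assumes "\<eta> > 0"
  shows "lambda_root M F \<eta> \<xi> \<omega> = decay_rate (Complex \<eta> \<xi>) \<omega>"
proof -
  have "Re \<mu> > 0 \<and> det (system_symbol M F (Complex \<eta> \<xi>) \<omega> \<mu>) = 0 \<longleftrightarrow>
      \<mu> = decay_rate (Complex \<eta> \<xi>) \<omega>" for \<mu>
  proof (cases "Re \<mu> > 0")
    case True
    with assms have "Complex \<eta> \<xi> + \<mu> \<noteq> 0"
      by (auto simp: complex_eq_iff)
    with True assms show ?thesis
      using det_system_symbol_eq_0_iff elastic_factor_nonzero[of "Complex \<eta> \<xi>" \<mu>]
        acoustic_root_unique[of "Complex \<eta> \<xi>" \<mu>] by simp
  next
    case False
    then show ?thesis
      using Re_decay_rate_pos[of "Complex \<eta> \<xi>" \<omega>] assms by auto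
  qed
  then show ?thesis
    unfolding lambda_root_def by simp
qed

text \<open>At \<open>\<eta> = 0\<close> the \<open>Lim\<close> in \<open>lambda_plus\<close> is a
  genuine limit, by continuity of \<open>decay_rate\<close> up to the imaginary axis.\<close>

lemma lambda_plus_eq:
  assumes "\<eta> \<ge> 0"
  shows "lambda_plus M F \<eta> \<xi> \<omega> = decay_rate (Complex \<eta> \<xi>) \<omega>"
proof (cases "\<eta> > 0")
  case True
  then show ?thesis by (simp add: lambda_plus_def lambda_root_eq)
next
  case False
  with assms have "\<eta> = 0" by simp
  have "((\<lambda>\<eta>'. decay_rate (Complex \<eta>' \<xi>) \<omega>) \<longlongrightarrow> decay_rate (Complex 0 \<xi>) \<omega>) (at_right 0)"
  proof (rule continuous_on_tendsto_compose[OF continuous_on_decay_rate])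
    show "((\<lambda>\<eta>'. Complex \<eta>' \<xi>) \<longlongrightarrow> Complex 0 \<xi>) (at_right 0)"
      by (intro tendsto_intros)
    show "\<forall>\<^sub>F \<eta>' in at_right 0. Complex \<eta>' \<xi> \<in> {s. Re s \<ge> 0}"
      using eventually_at_right_less by eventually_elim simp
  qed simp
  moreover have "\<forall>\<^sub>F \<eta>' in at_right 0. decay_rate (Complex \<eta>' \<xi>) \<omega> = lambda_root M F \<eta>' \<xi> \<omega>"
    using eventually_at_right_less by eventually_elim (simp add: lambda_root_eq)
  ultimately have "((\<lambda>\<eta>'. lambda_root M F \<eta>' \<xi> \<omega>) \<longlongrightarrow> decay_rate (Complex 0 \<xi>) \<omega>) (at_right 0)"
    using tendsto_cong by fast
  with \<open>\<eta> = 0\<close> show ?thesis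
    by (simp add: lambda_plus_def tendsto_Lim)
qed

text \<open>On the imaginary axis the comparison of real parts is no longer strict; there the
  dispersion relation itself excludes degeneracy and keeps the kernel one-dimensional at the
  boundary frequencies.\<close>

lemma decay_rate_nondegenerate:
  assumes "Re s \<ge> 0" "s \<noteq> 0 \<or> \<omega> \<noteq> 0"
  shows "s + decay_rate s \<omega> \<noteq> 0" "elastic_factor s \<omega> (decay_rate s \<omega>) \<noteq> 0"
proof -
  define \<mu> where "\<mu> = decay_rate s \<omega>"
  have ac: "elastic_factor s \<omega> \<mu> = \<mu>\<^sup>2 - (of_real \<omega>)\<^sup>2"
    using acoustic_factor_decay_rate[of s \<omega>] by (simp add: \<mu>_def acoustic_factor_def)
  have "s + \<mu> \<noteq> 0 \<and> elastic_factor s \<omega> \<mu> \<noteq> 0"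
  proof (cases "Re s > 0")
    case True
    then show ?thesis
      using elastic_factor_nonzero[of s \<mu> \<omega>] Re_decay_rate_pos[of s \<omega>]
      by (auto simp: \<mu>_def complex_eq_iff)
  next
    case False
    with assms obtain \<xi> where s: "s = \<i> * of_real \<xi>" and nz: "\<xi> \<noteq> 0 \<or> \<omega> \<noteq> 0"
      by (auto simp: complex_eq_iff intro!: that[of "Im s"])
    have "s + \<mu> \<noteq> 0"
    proof
      assume "s + \<mu> = 0"
      then have "\<mu> = - \<i> * of_real \<xi>"
        by (simp add: s add_eq_0_iff)
      moreover have "\<i>\<^sup>2 = - 1" by simp
      \<comment> \<open>For \<open>\<mu> = - s\<close> the dispersion relation becomes the vanishing
        of a positive definite form in \<xi> and \<omega>.\<close>
      ultimately have "complex_of_real ((1 + A) * \<xi>\<^sup>2 + (1 + B) * \<omega>\<^sup>2) = 0"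
        using ac[unfolded elastic_factor_def] \<open>s + \<mu> = 0\<close>
        unfolding of_real_add of_real_mult of_real_power of_real_1 by algebra
      then have "(1 + A) * \<xi>\<^sup>2 + (1 + B) * \<omega>\<^sup>2 = 0"
        by (simp only: of_real_eq_0_iff)
      moreover have "(1 + A) * \<xi>\<^sup>2 \<ge> 0" "(1 + B) * \<omega>\<^sup>2 \<ge> 0"
        using A_nonneg B_nonneg by simp_all
      ultimately have "(1 + A) * \<xi>\<^sup>2 = 0" "(1 + B) * \<omega>\<^sup>2 = 0"
        by linarith+
      with nz A_nonneg B_nonneg show False by auto
    qed
    moreover have "elastic_factor s \<omega> \<mu> \<noteq> 0"
    proof
      assume el: "elastic_factor s \<omega> \<mu> = 0"
      \<comment> \<open>A vanishing elastic factor forces \<mu> to be real while \<open>s\<close> is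
        imaginary, so real and imaginary parts give two separate equations.\<close>
      with ac have "\<mu> = of_real \<omega> \<or> \<mu> = - of_real \<omega>"
        by (simp add: power2_eq_iff)
      then obtain m where m: "\<mu> = of_real m" "m\<^sup>2 = \<omega>\<^sup>2"
        by (metis of_real_minus power2_minus)
      have "Re (elastic_factor s \<omega> \<mu>) = M\<^sup>2 * (m\<^sup>2 - \<xi>\<^sup>2) - A * m\<^sup>2 + \<omega>\<^sup>2 * B"
        and "Im (elastic_factor s \<omega> \<mu>) = 2 * M\<^sup>2 * m * \<xi>"
        by (simp_all add: elastic_factor_def s m(1) power2_eq_square algebra_simps)
      with el have re: "M\<^sup>2 * (\<omega>\<^sup>2 - \<xi>\<^sup>2) - A * \<omega>\<^sup>2 + \<omega>\<^sup>2 * B = 0" and "m * \<xi> = 0"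
        using m(2) M_pos by simp_all
      then consider "\<omega> = 0" | "\<xi> = 0" using m(2) by auto
      then show False
      proof cases
        case 1
        with re nz M_pos show False by simp
      next
        case 2
        with re have "\<omega>\<^sup>2 * ((M\<^sup>2 - A) + B) = 0" by (simp add: algebra_simps)
        with 2 nz A_pos B_nonneg show False by simp
      qed
    qed
    ultimately show ?thesis by simp
  qed
  then show "s + decay_rate s \<omega> \<noteq> 0" "elastic_factor s \<omega> (decay_rate s \<omega>) \<noteq> 0"
    by (simp_all add: \<mu>_def)
qed

section \<open>Boundary vectors and the reduced Lopatinski determinant\<close>

text \<open>The second boundary condition reads \<open>s * U$3 = w * U$1\<close>; taking
  \<open>s\<close> and \<open>w\<close> as the two entries solves it without division, also for
  \<open>s = 0\<close>.\<close>

definition boundary_solution :: "complex \<Rightarrow> real \<Rightarrow> complex^7" where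
  "boundary_solution s \<omega> = (let w = \<i> * of_real (\<omega> * a0 M R F) in vector
     [s, - of_real (d0 M F) * s, w,
      - of_real (F$1$1) * s + of_real (F$2$1 / R) * w, of_real (F$1$1) * w,
      - of_real (F$1$2) * s + of_real (F$2$2 / R) * w, of_real (F$1$2) * w])"

lemma beta_square: "(beta M F)\<^sup>2 = 1 + A - M\<^sup>2" and M_star_square: "(M_star F)\<^sup>2 = 1 + A"
  using less_A by (simp_all add: beta_def M_star_def A_def add_ac)

lemma a0_nonzero: "a0 M R F \<noteq> 0"
  using A_less_less R_pos M_pos by (simp add: a0_def beta_square)

text \<open>Since \<open>a0 M R F\<close> is nonzero, \<open>s\<close> and \<open>w\<close> do not
  both vanish, so the pair of first and third entries is a multiple of \<open>(s, w)\<close>; the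
  remaining entries are then determined.\<close>

lemma boundary_symbol_iff:
  assumes "s \<noteq> 0 \<or> \<omega> \<noteq> 0"
  shows "boundary_symbol M R F s \<omega> U \<longleftrightarrow> (\<exists>t. U = t *s boundary_solution s \<omega>)"
proof
  assume U: "boundary_symbol M R F s \<omega> U"
  define w where "w = \<i> * complex_of_real (\<omega> * a0 M R F)"
  have sw: "s * U$3 = w * U$1"
    using U by (simp add: boundary_symbol_def ell0_eq_0 w_def)
  have "s \<noteq> 0 \<or> w \<noteq> 0"
    using assms a0_nonzero by (simp add: w_def)
  then obtain t where t: "U$1 = t * s" "U$3 = t * w"
  proof
    assume "s \<noteq> 0"
    with sw show ?thesis
      by (intro that[of "U$1 / s"]) (simp_all add: field_simps)
  next
    assume "w \<noteq> 0"
    with sw show ?thesis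
      by (intro that[of "U$3 / w"]) (simp_all add: field_simps)
  qed
  have "U$2 + of_real (d0 M F) * (t * s) = 0"
    "U$4 + of_real (F$1$1) * (t * s) - of_real (F$2$1 / R) * (t * w) = 0"
    "U$6 + of_real (F$1$2) * (t * s) - of_real (F$2$2 / R) * (t * w) = 0"
    "U$5 - of_real (F$1$1) * (t * w) = 0" "U$7 - of_real (F$1$2) * (t * w) = 0"
    using U unfolding boundary_symbol_def ell0_eq_0 t by simp_all
  then have "U$2 = t * (- of_real (d0 M F) * s)"
    "U$4 = t * (- of_real (F$1$1) * s + of_real (F$2$1 / R) * w)"
    "U$6 = t * (- of_real (F$1$2) * s + of_real (F$2$2 / R) * w)"
    "U$5 = t * (of_real (F$1$1) * w)" "U$7 = t * (of_real (F$1$2) * w)"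
    by algebra+
  with t have "U = t *s boundary_solution s \<omega>"
    unfolding vec_eq_iff forall_7 boundary_solution_def Let_def w_def[symmetric] vector_7
      vector_smult_component by blast
  then show "\<exists>t. U = t *s boundary_solution s \<omega>" ..
next
  assume "\<exists>t. U = t *s boundary_solution s \<omega>"
  then show "boundary_symbol M R F s \<omega> U"
    by (auto simp: boundary_symbol_def boundary_solution_def Let_def vector_7 ell0_eq_0 algebra_simps)
qed

text \<open>What remains of the Lopatinski determinant once the dispersion relation has been used
  and the nonvanishing factors are removed.\<close>

definition lopatinski_function :: "complex \<Rightarrow> real \<Rightarrow> complex" where
  "lopatinski_function s \<omega> = of_real (1 + A - M\<^sup>2) * (decay_rate s \<omega>)\<^sup>2
     + of_real (\<omega>\<^sup>2 * (R * (M\<^sup>2 - A) - 1))"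

lemma A1_mult:
  "map_matrix complex_of_real (A1 M F) *v U = vector
     [U$1 + U$2, U$1 + (of_real M)\<^sup>2 * U$2 - of_real (F$1$1) * U$4 - of_real (F$1$2) * U$6,
      (of_real M)\<^sup>2 * U$3 - of_real (F$1$1) * U$5 - of_real (F$1$2) * U$7,
      U$4 - of_real (F$1$1) * U$2, U$5 - of_real (F$1$1) * U$3,
      U$6 - of_real (F$1$2) * U$2, U$7 - of_real (F$1$2) * U$3]"
  unfolding vec_eq_iff forall_7
  by (simp add: matrix_vector_mult_def sum_7 vector_7 map_matrix_def A1_def)

text \<open>The factor \<open>2 * M\<^sup>2\<close> clears the denominators of \<open>d0\<close> and
  \<open>a0\<close>. Orthogonality of the rows lets \<open>F\<close> enter only through
  \<open>A\<close> and \<open>B\<close>.\<close>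

lemma boundary_solution_dot_mode:
  fixes s :: complex and \<omega> :: real
  defines "\<mu> \<equiv> decay_rate s \<omega>"
  shows "2 * (of_real M)\<^sup>2 *
      (\<Sum>i\<in>UNIV. (map_matrix complex_of_real (A1 M F) *v boundary_solution s \<omega>) $ i * mode s \<omega> \<mu> $ i)
    = - of_real (1 + A - M\<^sup>2) * (s + \<mu>) * lopatinski_function s \<omega>"
proof -
  define w where "w = \<i> * complex_of_real (\<omega> * a0 M R F)"
  define m r A' B' d z :: complex
    where "m = of_real M" and "r = of_real R" and "A' = of_real A" and "B' = of_real B"
      and "d = of_real (d0 M F)" and "z = of_real \<omega>"
  define f1 f2 g1 g2 h1 h2 :: complex
    where "f1 = of_real (F$1$1)" and "f2 = of_real (F$1$2)" and "g1 = of_real (F$2$1)"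
      and "g2 = of_real (F$2$2)" and "h1 = of_real (F$2$1 / R)" and "h2 = of_real (F$2$2 / R)"
  define Q where "Q = elastic_factor s \<omega> \<mu>"
  have i: "\<i>\<^sup>2 = -1" by simp
  have h: "r * h1 = g1" "r * h2 = g2"
    using R_pos by (simp_all add: r_def h1_def h2_def g1_def g2_def)
  have AB: "A' = f1\<^sup>2 + f2\<^sup>2" "B' = g1\<^sup>2 + g2\<^sup>2"
    by (simp_all add: A'_def B'_def A_def B_def f1_def f2_def g1_def g2_def)
  have "complex_of_real (F$1$1 * F$2$1 + F$1$2 * F$2$2) = 0"
    using ell0_eq_0 by (simp only: ell0_def of_real_0)
  then have fg: "f1 * g1 + f2 * g2 = 0"
    by (simp add: f1_def f2_def g1_def g2_def)
  have "r \<noteq> 0" using R_pos by (simp add: r_def)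
  moreover have "r * (f1 * h1 + f2 * h2) = 0"
    using h fg by (simp add: distrib_left mult.left_commute[of r])
  ultimately have fh: "f1 * h1 + f2 * h2 = 0" by simp
  have "2 * M\<^sup>2 * d0 M F = 1 + A + M\<^sup>2"
    using M_pos by (simp add: d0_def M_star_square)
  from arg_cong[OF this, of complex_of_real] have d: "2 * m\<^sup>2 * d = 1 + A' + m\<^sup>2"
    by (simp add: m_def d_def A'_def)
  have "2 * M\<^sup>2 * a0 M R F = - ((1 + A - M\<^sup>2) * R)"
    using M_pos by (simp add: a0_def beta_square)
  from arg_cong[OF this, of complex_of_real]
  have "2 * m\<^sup>2 * complex_of_real (a0 M R F) = - ((1 + A' - m\<^sup>2) * r)"
    by (simp add: m_def r_def A'_def)
  moreover have "w = \<i> * (z * of_real (a0 M R F))"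
    by (simp add: w_def z_def)
  ultimately have w: "2 * m\<^sup>2 * w = - (\<i> * z * ((1 + A' - m\<^sup>2) * r))"
    by algebra
  have Q: "Q = m\<^sup>2 * (s + \<mu>)\<^sup>2 - A' * \<mu>\<^sup>2 + z\<^sup>2 * B'" "Q = \<mu>\<^sup>2 - z\<^sup>2"
    using acoustic_factor_decay_rate[of s \<omega>]
    by (simp_all add: Q_def elastic_factor_def acoustic_factor_def m_def z_def A'_def B'_def \<mu>_def)
  have "(\<Sum>i\<in>UNIV. (map_matrix complex_of_real (A1 M F) *v boundary_solution s \<omega>) $ i * mode s \<omega> \<mu> $ i)
    = (1 - d) * s * Q
      - (s + m\<^sup>2 * (- d * s) - f1 * (- f1 * s + h1 * w) - f2 * (- f2 * s + h2 * w)) * ((s + \<mu>) * \<mu>)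
      - (m\<^sup>2 * w - f1 * (f1 * w) - f2 * (f2 * w)) * ((s + \<mu>) * (\<i> * z))
      - (f1 * d * s - f1 * s + h1 * w) * ((f1 * \<mu> + g1 * (\<i> * z)) * \<mu>)
      - (f2 * d * s - f2 * s + h2 * w) * ((f2 * \<mu> + g2 * (\<i> * z)) * \<mu>)" (is "?S = _")
    unfolding sum_7 A1_mult mode_def boundary_solution_def Let_def vector_7
      m_def[symmetric] d_def[symmetric] f1_def[symmetric] f2_def[symmetric] g1_def[symmetric]
      g2_def[symmetric] h1_def[symmetric] h2_def[symmetric] z_def[symmetric] Q_def[symmetric]
      w_def[symmetric]
    by algebra
  also have "\<dots> = (1 - d) * s * Q - (1 + A' - m\<^sup>2 * d) * s * ((s + \<mu>) * \<mu>)
      - (m\<^sup>2 - A') * w * ((s + \<mu>) * (\<i> * z))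
      - (d - 1) * s * A' * \<mu>\<^sup>2 - w * (h1 * g1 + h2 * g2) * \<i> * z * \<mu>"
    using AB fg fh by algebra
  finally have S: "?S = \<dots>" .
  have hg: "r * (h1 * g1 + h2 * g2) = B'"
    by (simp add: distrib_left AB h power2_eq_square flip: mult.assoc)
  define k where "k = h1 * g1 + h2 * g2"
  \<comment> \<open>The last summand is 0 by the equation for \<open>d\<close>; writing it out makes
    the step a pure polynomial identity.\<close>
  have "2 * m\<^sup>2 * ?S = - (1 + A' - m\<^sup>2) * s * (Q + m\<^sup>2 * (s + \<mu>) * \<mu> + A' * \<mu>\<^sup>2)
      - (2 * m\<^sup>2 * w) * (\<i> * z) * ((m\<^sup>2 - A') * (s + \<mu>) + k * \<mu>)
      + s * (1 + A' + m\<^sup>2 - 2 * m\<^sup>2 * d) * (Q - (s + \<mu>) * \<mu> * m\<^sup>2 + A' * \<mu>\<^sup>2)"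
    unfolding S k_def[symmetric] by algebra
  also have "\<dots> = - (1 + A' - m\<^sup>2) * (s * (Q + m\<^sup>2 * (s + \<mu>) * \<mu> + A' * \<mu>\<^sup>2)
      + z\<^sup>2 * (r * (m\<^sup>2 - A') * (s + \<mu>) + r * k * \<mu>))"
    unfolding w using d i by algebra
  \<comment> \<open>One expression for \<open>Q\<close> eliminates \<open>B'\<close>, which lets
    \<open>s + \<mu>\<close> factor out; the other then replaces the remaining
    \<open>Q\<close>.\<close>
  also have "\<dots> = - (1 + A' - m\<^sup>2) * (s + \<mu>) * ((1 + A' - m\<^sup>2) * \<mu>\<^sup>2 + z\<^sup>2 * (r * (m\<^sup>2 - A') - 1))"
    unfolding hg[folded k_def] using Q by algebra
  finally show ?thesis
    by (simp add: lopatinski_function_def \<mu>_def m_def r_def A'_def z_def)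
qed

text \<open>The freedom in \<open>lopatinski_matrix\<close> is harmless: the boundary vector is
  fixed up to a nonzero factor \<open>t\<close>, and every admissible row \<open>k\<close> leads to
  the same orthogonality condition.\<close>

lemma lopatinski_nonzero_iff:
  assumes "\<eta> \<ge> 0" "\<eta>\<^sup>2 + \<xi>\<^sup>2 + \<omega>\<^sup>2 \<noteq> 0"
  shows "lopatinski_nonzero M R F \<eta> \<xi> \<omega> \<longleftrightarrow> lopatinski_function (Complex \<eta> \<xi>) \<omega> \<noteq> 0"
proof -
  define s \<mu> where "s = Complex \<eta> \<xi>" and "\<mu> = decay_rate s \<omega>"
  define S x u where "S = system_symbol M F s \<omega> \<mu>" and "x = mode s \<omega> \<mu>" and "u = boundary_solution s \<omega>"
  have nz: "s \<noteq> 0 \<or> \<omega> \<noteq> 0" and "Re s \<ge> 0"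
    using assms by (auto simp: s_def complex_eq_iff)
  note nondeg = decay_rate_nondegenerate[OF \<open>Re s \<ge> 0\<close> nz, folded \<mu>_def]
  have sym: "transpose S = S"
    by (simp add: S_def transpose_system_symbol)
  have ker: "S *v y = 0 \<longleftrightarrow> (\<exists>t. y = t *s x)" for y
    unfolding S_def x_def
    using system_symbol_kernel_iff[OF nondeg] acoustic_factor_decay_rate by (simp add: \<mu>_def)
  have x1: "x $ 1 \<noteq> 0"
    using nondeg(2) by (simp add: x_def mode_def vector_7)
  then have "x \<noteq> 0" by auto
  have "u \<noteq> 0"
  proof
    assume "u = 0"
    then have "u $ 1 = 0" "u $ 3 = 0" by simp_all
    then show False
      using nz a0_nonzero by (auto simp: u_def boundary_solution_def Let_def vector_7)
  qed
  have zero_iff: "det (\<chi> i. if i = k then map_matrix complex_of_real (A1 M F) *v (t *s u) else S $ i) = 0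
      \<longleftrightarrow> lopatinski_function s \<omega> = 0" if "x $ k \<noteq> 0" "t \<noteq> 0" for k t
  proof -
    have "(\<Sum>i\<in>UNIV. (map_matrix complex_of_real (A1 M F) *v (t *s u)) $ i * x $ i)
        = t * (\<Sum>i\<in>UNIV. (map_matrix complex_of_real (A1 M F) *v u) $ i * x $ i)"
      by (simp add: vec.scale sum_distrib_left mult.assoc)
    then have eq: "2 * (of_real M)\<^sup>2 *
        (\<Sum>i\<in>UNIV. (map_matrix complex_of_real (A1 M F) *v (t *s u)) $ i * x $ i)
      = t * (- of_real (1 + A - M\<^sup>2) * (s + \<mu>) * lopatinski_function s \<omega>)"
      using boundary_solution_dot_mode[of s \<omega>, folded \<mu>_def, folded u_def x_def]
      by (simp only: mult.left_commute[of _ t])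
    have "(\<Sum>i\<in>UNIV. (map_matrix complex_of_real (A1 M F) *v (t *s u)) $ i * x $ i) = 0 \<longleftrightarrow>
        t * (- of_real (1 + A - M\<^sup>2) * (s + \<mu>) * lopatinski_function s \<omega>) = 0"
      unfolding eq[symmetric] mult_eq_0_iff using M_pos by simp
    also have "\<dots> \<longleftrightarrow> lopatinski_function s \<omega> = 0"
      unfolding mult_eq_0_iff neg_equal_0_iff_equal
      using of_real_coefficient_nonzero nondeg(1) that(2) by blast
    finally show ?thesis
      unfolding det_replace_row_eq_0_iff[OF sym ker that(1)] .
  qed
  have lop: "lopatinski_matrix M R F s \<omega> \<mu> L \<longleftrightarrow> (\<exists>t k. t \<noteq> 0 \<and> x $ k \<noteq> 0 \<and>
      L = (\<chi> i. if i = k then map_matrix complex_of_real (A1 M F) *v (t *s u) else S $ i))" for L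
  proof -
    have rows: "inj_on (($) S) (- {k}) \<and> vec.independent (($) S ` (- {k})) \<and> Z \<longleftrightarrow> x $ k \<noteq> 0 \<and> Z" for k Z
      using independent_remaining_rows_iff[OF sym ker \<open>x \<noteq> 0\<close>, of k] by blast
    have "lopatinski_matrix M R F s \<omega> \<mu> L \<longleftrightarrow> (\<exists>U k. U \<noteq> 0 \<and> (\<exists>t. U = t *s u) \<and> x $ k \<noteq> 0 \<and>
      L = (\<chi> i. if i = k then map_matrix complex_of_real (A1 M F) *v U else S $ i))"
      unfolding lopatinski_matrix_def S_def[symmetric] boundary_symbol_iff[OF nz] u_def[symmetric]
        rows ..
    also have "\<dots> \<longleftrightarrow> (\<exists>t k. t *s u \<noteq> 0 \<and> x $ k \<noteq> 0 \<and>
      L = (\<chi> i. if i = k then map_matrix complex_of_real (A1 M F) *v (t *s u) else S $ i))"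
      by blast
    also have "\<dots> \<longleftrightarrow> (\<exists>t k. t \<noteq> 0 \<and> x $ k \<noteq> 0 \<and>
      L = (\<chi> i. if i = k then map_matrix complex_of_real (A1 M F) *v (t *s u) else S $ i))"
      using \<open>u \<noteq> 0\<close> by simp
    finally show ?thesis .
  qed
  \<comment> \<open>Row 1 can always be dropped, because the first entry of the kernel vector is the
    elastic factor.\<close>
  have ex: "\<exists>L. lopatinski_matrix M R F s \<omega> \<mu> L"
    unfolding lop using x1 one_neq_zero by blast
  have det: "det L = 0 \<longleftrightarrow> lopatinski_function s \<omega> = 0" if "lopatinski_matrix M R F s \<omega> \<mu> L" for L
    using that zero_iff unfolding lop by blast
  show ?thesis
    unfolding lopatinski_nonzero_def lambda_plus_eq[OF assms(1)] s_def[symmetric] \<mu>_def[symmetric]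
    using ex det by blast
qed

section \<open>Location and existence of zeros\<close>

text \<open>Eliminating \<open>\<mu>\<^sup>2\<close> by the dispersion relation gives a second form,
  in which the coefficient of \<open>\<omega>\<^sup>2\<close> is positive.\<close>

lemma lopatinski_function_alt:
  "lopatinski_function s \<omega> = of_real (M\<^sup>2) * s\<^sup>2 + 2 * of_real (M\<^sup>2) * s * decay_rate s \<omega>
     + of_real (\<omega>\<^sup>2 * (B + R * (M\<^sup>2 - A)))"
  using acoustic_factor_decay_rate[of s \<omega>]
  unfolding lopatinski_function_def acoustic_factor_def elastic_factor_def
    of_real_add of_real_diff of_real_mult of_real_power of_real_1
  by algebra

text \<open>If the decay rate had positive real part, the first form would make it real; the
  imaginary part of the second form would make \<open>s\<close> real, and the second form would then
  be a sum of nonnegative terms that cannot all vanish. So the decay rate is imaginary, and with it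
  \<open>s\<close>.\<close>

lemma lopatinski_zero_on_imaginary_axis:
  assumes "Re s \<ge> 0" "s \<noteq> 0 \<or> \<omega> \<noteq> 0" "lopatinski_function s \<omega> = 0"
  shows "Re s = 0" "Re (decay_rate s \<omega>) = 0" "\<omega> \<noteq> 0"
    "(1 + A - M\<^sup>2) * (Im (decay_rate s \<omega>))\<^sup>2 = \<omega>\<^sup>2 * (R * (M\<^sup>2 - A) - 1)"
proof -
  define x y \<sigma> \<tau> where "x = Re (decay_rate s \<omega>)" and "y = Im (decay_rate s \<omega>)"
    and "\<sigma> = Re s" and "\<tau> = Im s"
  have "\<sigma> \<ge> 0" using assms by (simp add: \<sigma>_def)
  have "x \<ge> 0"
    using Re_decay_rate_nonneg[OF assms(1)] by (simp add: x_def)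
  have alt: "M\<^sup>2 * (\<sigma>\<^sup>2 - \<tau>\<^sup>2) + 2 * M\<^sup>2 * (\<sigma> * x - \<tau> * y) + \<omega>\<^sup>2 * (B + R * (M\<^sup>2 - A)) = 0"
    "2 * M\<^sup>2 * (\<sigma> * \<tau>) + 2 * M\<^sup>2 * (\<sigma> * y + \<tau> * x) = 0"
    using arg_cong[OF assms(3)[unfolded lopatinski_function_alt], of Re]
      arg_cong[OF assms(3)[unfolded lopatinski_function_alt], of Im]
    by (simp_all add: Re_power2 Im_power2 x_def y_def \<sigma>_def \<tau>_def algebra_simps
        del: of_real_add of_real_diff of_real_power of_real_mult)
  have parts: "(1 + A - M\<^sup>2) * (x\<^sup>2 - y\<^sup>2) + \<omega>\<^sup>2 * (R * (M\<^sup>2 - A) - 1) = 0"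
    "(1 + A - M\<^sup>2) * (2 * x * y) = 0"
    using arg_cong[OF assms(3)[unfolded lopatinski_function_def], of Re]
      arg_cong[OF assms(3)[unfolded lopatinski_function_def], of Im]
    by (simp_all add: Re_power2 Im_power2 x_def y_def
        del: of_real_add of_real_diff of_real_power of_real_mult)
  have pos: "B + R * (M\<^sup>2 - A) > 0"
    using B_nonneg R_pos A_pos by (simp add: add_nonneg_pos)
  have "x = 0"
  proof (rule ccontr)
    assume "x \<noteq> 0"
    with \<open>x \<ge> 0\<close> have "x > 0" by simp
    with parts(2) A_less_less have "y = 0" by simp
    with alt(2) have "M\<^sup>2 * (\<tau> * (\<sigma> + x)) = 0"
      by (simp add: algebra_simps)
    with M_pos \<open>x > 0\<close> \<open>\<sigma> \<ge> 0\<close> have "\<tau> = 0" by simp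
    have "M\<^sup>2 * \<sigma>\<^sup>2 \<ge> 0" "2 * M\<^sup>2 * (\<sigma> * x) \<ge> 0" "\<omega>\<^sup>2 * (B + R * (M\<^sup>2 - A)) \<ge> 0"
      using \<open>x > 0\<close> \<open>\<sigma> \<ge> 0\<close> pos by simp_all
    moreover have "M\<^sup>2 * \<sigma>\<^sup>2 + 2 * M\<^sup>2 * (\<sigma> * x) + \<omega>\<^sup>2 * (B + R * (M\<^sup>2 - A)) = 0"
      using alt(1) \<open>y = 0\<close> \<open>\<tau> = 0\<close> by simp
    ultimately have "M\<^sup>2 * \<sigma>\<^sup>2 = 0" "\<omega>\<^sup>2 * (B + R * (M\<^sup>2 - A)) = 0"
      by linarith+
    with M_pos pos have "\<sigma> = 0" "\<omega> = 0" by simp_all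
    with assms(2) \<open>\<tau> = 0\<close> show False by (simp add: \<sigma>_def \<tau>_def complex_eq_iff)
  qed
  then show "Re (decay_rate s \<omega>) = 0" by (simp add: x_def)
  then show "Re s = 0"
    using assms(1) Re_decay_rate_pos[of s \<omega>] by fastforce
  from parts(1) \<open>x = 0\<close>
  show im: "(1 + A - M\<^sup>2) * (Im (decay_rate s \<omega>))\<^sup>2 = \<omega>\<^sup>2 * (R * (M\<^sup>2 - A) - 1)"
    by (simp add: y_def)
  show "\<omega> \<noteq> 0"
  proof
    assume "\<omega> = 0"
    with im A_less_less have "y = 0" by (simp add: y_def)
    with \<open>x = 0\<close> have "decay_rate s \<omega> = 0"
      by (simp add: x_def y_def complex_eq_iff)
    with \<open>\<omega> = 0\<close> assms(3) M_pos have "s = 0"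
      by (simp add: lopatinski_function_alt)
    with assms(2) \<open>\<omega> = 0\<close> show False by simp
  qed
qed

lemma lopatinski_condition: "lopatinski_condition M R F"
  unfolding lopatinski_condition_def
proof (intro allI impI)
  fix \<eta> \<xi> \<omega> :: real
  assume "\<eta> > 0"
  then have "\<eta>\<^sup>2 + \<xi>\<^sup>2 + \<omega>\<^sup>2 \<noteq> 0"
    by (metis add_pos_nonneg less_irrefl zero_le_power2 zero_less_power)
  with \<open>\<eta> > 0\<close> show "lopatinski_nonzero M R F \<eta> \<xi> \<omega>"
    using lopatinski_zero_on_imaginary_axis(1)[of "Complex \<eta> \<xi>" \<omega>]
    by (auto simp: lopatinski_nonzero_iff complex_eq_iff)
qed

lemma radical_imaginary_axis:
  assumes "Re s = 0"
  shows "Re (radical s \<omega>) * Im (radical s \<omega>) = 0"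
    "(Im (radical s \<omega>))\<^sup>2 - (Re (radical s \<omega>))\<^sup>2
      = M\<^sup>2 * (1 + A) * (Im s)\<^sup>2 - (1 + A - M\<^sup>2) * (1 + B) * \<omega>\<^sup>2"
proof -
  have "(M * sqrt (1 + A))\<^sup>2 = M\<^sup>2 * (1 + A)"
    using A_nonneg by (simp add: power_mult_distrib)
  with arg_cong[OF radical_square[of s \<omega>], of Re]
  show "(Im (radical s \<omega>))\<^sup>2 - (Re (radical s \<omega>))\<^sup>2
      = M\<^sup>2 * (1 + A) * (Im s)\<^sup>2 - (1 + A - M\<^sup>2) * (1 + B) * \<omega>\<^sup>2"
    using assms A_nonneg by (simp add: Re_power2 power_mult_distrib del: of_real_mult)
  show "Re (radical s \<omega>) * Im (radical s \<omega>) = 0"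
    using arg_cong[OF radical_square[of s \<omega>], of Im] assms
    by (simp add: Im_power2 del: of_real_mult)
qed

text \<open>At a zero, \<open>b * y\<close> is the sum of \<open>M\<^sup>2 * \<tau>\<close> and
  \<open>\<rho>\<close>, which do not have opposite signs, so its square is at least
  \<open>M^4 * \<tau>\<^sup>2\<close>. Since \<open>\<rho>\<^sup>2\<close> is nonnegative,
  \<open>\<tau>\<^sup>2\<close> is bounded below by a multiple of
  \<open>\<omega>\<^sup>2\<close>.\<close>

lemma lopatinski_zero_imp:
  assumes "Re s \<ge> 0" "s \<noteq> 0 \<or> \<omega> \<noteq> 0" "lopatinski_function s \<omega> = 0"
  shows "M\<^sup>2 * (1 + B) \<le> (1 + A) * (R * (M\<^sup>2 - A) - 1)"
proof -
  note zero = lopatinski_zero_on_imaginary_axis[OF assms]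
  define b q y \<tau> \<rho> where "b = 1 + A - M\<^sup>2" and "q = R * (M\<^sup>2 - A) - 1"
    and "y = Im (decay_rate s \<omega>)" and "\<tau> = Im s" and "\<rho> = Im (radical s \<omega>)"
  have "b > 0" using A_less_less by (simp add: b_def)
  have "Re (radical s \<omega>) = 0"
    using Re_decay_rate[of s \<omega>] zero(1,2) by simp
  then have rad: "\<rho>\<^sup>2 = M\<^sup>2 * (1 + A) * \<tau>\<^sup>2 - b * (1 + B) * \<omega>\<^sup>2"
    using radical_imaginary_axis(2)[OF zero(1), of \<omega>] by (simp add: \<rho>_def \<tau>_def b_def)
  have bdy: "b * y = M\<^sup>2 * \<tau> + \<rho>"
    using Im_decay_rate by (simp add: b_def y_def \<tau>_def \<rho>_def)
  have "\<rho> * \<tau> \<ge> 0"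
    using Im_radical_mult_Im_nonneg[OF assms(1), of \<omega>] by (simp add: \<rho>_def \<tau>_def)
  have "b * (\<omega>\<^sup>2 * q) = (b * y)\<^sup>2"
    using zero(4)[folded b_def q_def y_def] by algebra
  also have "\<dots> = M^4 * \<tau>\<^sup>2 + 2 * M\<^sup>2 * (\<rho> * \<tau>) + \<rho>\<^sup>2"
    unfolding bdy by algebra
  also have "\<dots> \<ge> M^4 * \<tau>\<^sup>2"
    using \<open>\<rho> * \<tau> \<ge> 0\<close> by simp
  finally have "(1 + A) * (M^4 * \<tau>\<^sup>2) \<le> (1 + A) * (b * (\<omega>\<^sup>2 * q))"
    using A_pos by (intro mult_left_mono) auto
  moreover have "(1 + A) * (M^4 * \<tau>\<^sup>2) = M\<^sup>2 * \<rho>\<^sup>2 + M\<^sup>2 * (b * (1 + B) * \<omega>\<^sup>2)"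
    unfolding rad by algebra
  moreover have "M\<^sup>2 * \<rho>\<^sup>2 \<ge> 0" by simp
  ultimately have "M\<^sup>2 * (b * (1 + B) * \<omega>\<^sup>2) \<le> (1 + A) * (b * (\<omega>\<^sup>2 * q))"
    by linarith
  then have "(b * \<omega>\<^sup>2) * (M\<^sup>2 * (1 + B)) \<le> (b * \<omega>\<^sup>2) * ((1 + A) * q)"
    by (simp add: mult_ac)
  moreover have "b * \<omega>\<^sup>2 > 0"
    using \<open>b > 0\<close> zero(3) by simp
  ultimately show ?thesis
    unfolding q_def using mult_le_cancel_left_pos by blast
qed

lemma lopatinski_zero_exists:
  assumes "M\<^sup>2 * (1 + B) \<le> (1 + A) * (R * (M\<^sup>2 - A) - 1)"
  shows "\<exists>\<tau>. lopatinski_function (Complex 0 \<tau>) 1 = 0"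
proof -
  define b q where "b = 1 + A - M\<^sup>2" and "q = R * (M\<^sup>2 - A) - 1"
  have "b > 0" using A_less_less by (simp add: b_def)
  have "M\<^sup>2 * (1 + B) > 0" using M_pos B_nonneg by simp
  with assms have "(1 + A) * q > 0" by (simp add: q_def)
  then have "q > 0" using A_pos by (simp add: zero_less_mult_iff)
  \<comment> \<open>The first form at a zero with \<open>\<omega> = 1\<close> forces
    \<open>b * y\<^sup>2 = q\<close>. Then \<open>\<tau>\<close> is the positive root of the
    quadratic equation given by the second form for \<open>s = \<i> * \<tau>\<close> and decay rate
    \<open>\<i> * y\<close>.\<close>
  define y where "y = sqrt (q / b)"
  define \<tau> where "\<tau> = sqrt (y\<^sup>2 + (q + 1 + B) / M\<^sup>2) - y"
  have "y > 0" and y: "b * y\<^sup>2 = q"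
    using \<open>q > 0\<close> \<open>b > 0\<close> by (simp_all add: y_def)
  have frac: "(q + 1 + B) / M\<^sup>2 > 0"
    using \<open>q > 0\<close> B_nonneg M_pos by simp
  then have "y < sqrt (y\<^sup>2 + (q + 1 + B) / M\<^sup>2)"
    by (intro real_less_rsqrt) simp
  then have "\<tau> > 0" by (simp add: \<tau>_def)
  have "(\<tau> + y)\<^sup>2 = y\<^sup>2 + (q + 1 + B) / M\<^sup>2"
    using frac by (simp add: \<tau>_def)
  then have "M\<^sup>2 * (\<tau> + y)\<^sup>2 = M\<^sup>2 * y\<^sup>2 + (q + 1 + B)"
    using M_pos by (simp only: distrib_left[of "M\<^sup>2" "y\<^sup>2"]) simp
  then have \<tau>: "M\<^sup>2 * \<tau>\<^sup>2 + 2 * M\<^sup>2 * y * \<tau> = q + 1 + B"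
    by (simp add: power2_eq_square algebra_simps)
  \<comment> \<open>The imaginary part that the radical must have for the decay rate to be
    \<open>\<i> * y\<close>. Its sign is where the assumed inequality enters:
    \<open>t\<^sup>2 + 2 * M\<^sup>2 * y * t\<close> increases in \<open>t > 0\<close>, so
    \<open>b * y\<close> and \<open>M\<^sup>2 * \<tau>\<close> can be compared through it.\<close>
  define g where "g = b * y - M\<^sup>2 * \<tau>"
  have "g \<ge> 0"
  proof (rule ccontr)
    assume "\<not> g \<ge> 0"
    then have less: "b * y < M\<^sup>2 * \<tau>" by (simp add: g_def)
    have "b * q + 2 * M\<^sup>2 * q = (b * y)\<^sup>2 + 2 * M\<^sup>2 * y * (b * y)"
      unfolding y[symmetric] by algebra
    also have "\<dots> < (M\<^sup>2 * \<tau>)\<^sup>2 + 2 * M\<^sup>2 * y * (M\<^sup>2 * \<tau>)"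
      using less \<open>y > 0\<close> \<open>b > 0\<close> M_pos
      by (intro add_strict_mono power_strict_mono mult_strict_left_mono) auto
    also have "\<dots> = M\<^sup>2 * (q + 1 + B)"
      unfolding \<tau>[symmetric] by algebra
    finally have "(1 + A) * q < M\<^sup>2 * (1 + B)"
      by (simp add: b_def algebra_simps)
    with assms show False by (simp add: q_def)
  qed
  define s where "s = Complex 0 \<tau>"
  have g2: "g\<^sup>2 = M\<^sup>2 * (1 + A) * \<tau>\<^sup>2 - b * (1 + B)"
    using \<tau> y b_def unfolding g_def by algebra
  have prod: "Re (radical s 1) * Im (radical s 1) = 0"
    and diff: "(Im (radical s 1))\<^sup>2 - (Re (radical s 1))\<^sup>2 = g\<^sup>2"
    using radical_imaginary_axis[of s 1] g2 by (simp_all add: s_def b_def)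
  \<comment> \<open>The radical squares to \<open>- g\<^sup>2\<close>; of the two candidates,
    \<open>\<tau> > 0\<close> selects the one with nonnegative imaginary part.\<close>
  have "Im (radical s 1) \<ge> 0"
    using Im_radical_mult_Im_nonneg[of s 1] \<open>\<tau> > 0\<close> by (simp add: s_def zero_le_mult_iff)
  have "Re (radical s 1) = 0"
  proof (rule ccontr)
    assume "Re (radical s 1) \<noteq> 0"
    moreover from this prod have "Im (radical s 1) = 0" by simp
    ultimately show False
      using diff by (smt (verit) zero_eq_power2 zero_le_power2)
  qed
  moreover from this diff have "Im (radical s 1) = g"
    using \<open>Im (radical s 1) \<ge> 0\<close> \<open>g \<ge> 0\<close> by (simp add: power2_eq_iff_nonneg)
  ultimately have "b * Re (decay_rate s 1) = 0" "b * Im (decay_rate s 1) = b * y"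
    using Re_decay_rate[of s 1] Im_decay_rate[of s 1] by (simp_all add: s_def b_def g_def)
  with \<open>b > 0\<close> have "decay_rate s 1 = Complex 0 y"
    by (simp add: complex_eq_iff)
  then have "lopatinski_function s 1 = of_real (q - b * y\<^sup>2)"
    by (simp add: lopatinski_function_def b_def q_def complex_eq_iff Re_power2 Im_power2
        del: of_real_add of_real_diff of_real_mult of_real_power)
  then show ?thesis
    using y by (auto simp: s_def)
qed

text \<open>Zeros exist exactly under the non-strict inequality of the two preceding lemmas, so
  equality already destroys uniform stability and the criterion is strict.\<close>

lemma uniform_lopatinski_condition_iff:
  "uniform_lopatinski_condition M R F \<longleftrightarrow>
    1 + A + M\<^sup>2 - R * (1 + A) * (M\<^sup>2 - A) + B * M\<^sup>2 > 0"
proof -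
  have "uniform_lopatinski_condition M R F \<longleftrightarrow> \<not> M\<^sup>2 * (1 + B) \<le> (1 + A) * (R * (M\<^sup>2 - A) - 1)"
  proof
    assume uniform: "uniform_lopatinski_condition M R F"
    show "\<not> M\<^sup>2 * (1 + B) \<le> (1 + A) * (R * (M\<^sup>2 - A) - 1)"
    proof
      assume "M\<^sup>2 * (1 + B) \<le> (1 + A) * (R * (M\<^sup>2 - A) - 1)"
      then obtain \<tau> where \<tau>: "lopatinski_function (Complex 0 \<tau>) 1 = 0"
        using lopatinski_zero_exists by blast
      have nz: "0\<^sup>2 + \<tau>\<^sup>2 + 1\<^sup>2 \<noteq> (0::real)"
        by (metis add_0 add_nonneg_pos less_irrefl power_zero_numeral zero_le_power2 zero_less_one one_power2)
      then have "lopatinski_nonzero M R F 0 \<tau> 1"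
        using uniform unfolding uniform_lopatinski_condition_def by blast
      with \<tau> nz show False
        using lopatinski_nonzero_iff[of 0 \<tau> 1] by simp
    qed
  next
    assume not_le: "\<not> M\<^sup>2 * (1 + B) \<le> (1 + A) * (R * (M\<^sup>2 - A) - 1)"
    show "uniform_lopatinski_condition M R F"
      unfolding uniform_lopatinski_condition_def
    proof (intro allI impI)
      fix \<eta> \<xi> \<omega> :: real
      assume *: "\<eta> \<ge> 0" "\<eta>\<^sup>2 + \<xi>\<^sup>2 + \<omega>\<^sup>2 \<noteq> 0"
      then have "Complex \<eta> \<xi> \<noteq> 0 \<or> \<omega> \<noteq> 0"
        by (auto simp: complex_eq_iff)
      with not_le * show "lopatinski_nonzero M R F \<eta> \<xi> \<omega>"
        using lopatinski_zero_imp[of "Complex \<eta> \<xi>" \<omega>] by (auto simp: lopatinski_nonzero_iff)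
    qed
  qed
  then show ?thesis
    by (simp add: algebra_simps not_le)
qed

end

section \<open>The two particular cases of the shock wave\<close>

theorem proposition5p1:
  fixes p :: "real \<Rightarrow> real"
    and \<rho>p \<rho>m :: real
    and vp vm :: "real^2"
    and Fp Fm F :: "real^2^2"
    and M Mm R :: real
  assumes "smooth_pressure p"
    and "rectilinear_shock p \<rho>p vp Fp \<rho>m vm Fm"
    and "M = vp $ 1 / sound_speed p \<rho>p"
    and "Mm = vm $ 1 / sound_speed p \<rho>m"
    and "R = \<rho>p / \<rho>m"
    and "F = (\<chi> i j. Fp $ i $ j / sound_speed p \<rho>p)"
    and "lax_conditions M Mm F"
  shows "(F$1$2 = 0 \<and> F$2$1 = 0 \<or> F$1$1 = 0 \<and> F$2$2 = 0 \<longrightarrow> lopatinski_condition M R F) \<and>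
    (F$1$2 = 0 \<and> F$2$1 = 0 \<longrightarrow>
      (uniform_lopatinski_condition M R F \<longleftrightarrow>
        1 + (F$1$1)\<^sup>2 + M\<^sup>2 - R * (1 + (F$1$1)\<^sup>2) * (M\<^sup>2 - (F$1$1)\<^sup>2) + (F$2$2)\<^sup>2 * M\<^sup>2 > 0)) \<and>
    (F$1$1 = 0 \<and> F$2$2 = 0 \<longrightarrow>
      (uniform_lopatinski_condition M R F \<longleftrightarrow>
        1 + (F$1$2)\<^sup>2 + M\<^sup>2 - R * (1 + (F$1$2)\<^sup>2) * (M\<^sup>2 - (F$1$2)\<^sup>2) + (F$2$1)\<^sup>2 * M\<^sup>2 > 0))"
proof -
  define A B where "A = (F$1$1)\<^sup>2 + (F$1$2)\<^sup>2" and "B = (F$2$1)\<^sup>2 + (F$2$2)\<^sup>2"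
  have lax: "sqrt A < M" "M < sqrt (1 + A)"
    using assms(7) by (simp_all add: lax_conditions_def A_def add.assoc)
  have "A \<ge> 0" by (simp add: A_def)
  then have "M > 0"
    using lax(1) real_sqrt_ge_zero[of A] by linarith
  have "A < M\<^sup>2"
    using lax(1) \<open>M > 0\<close> by (metis sqrt_le_D not_less less_imp_le real_le_rsqrt)
  have "M\<^sup>2 < (sqrt (1 + A))\<^sup>2"
    using lax(2) \<open>M > 0\<close> by (intro power_strict_mono) auto
  then have "M\<^sup>2 < 1 + A" using \<open>A \<ge> 0\<close> by simp
  have "R > 0"
    using assms(2,5) by (simp add: rectilinear_shock_def)
  have orthogonal: "orthogonal_shock M R F A B" if "ell0 F = 0"
    using that \<open>M > 0\<close> \<open>R > 0\<close> \<open>A < M\<^sup>2\<close> \<open>M\<^sup>2 < 1 + A\<close> A_def B_def by unfold_locales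
  have ell0: "ell0 F = 0" if "F$1$2 = 0 \<and> F$2$1 = 0 \<or> F$1$1 = 0 \<and> F$2$2 = 0"
    using that by (auto simp: ell0_def)
  \<comment> \<open>In each case one entry of either row vanishes, so \<open>A\<close> and
    \<open>B\<close> reduce to the single squares in the two criteria.\<close>
  show ?thesis
    using orthogonal_shock.lopatinski_condition[OF orthogonal[OF ell0]]
      orthogonal_shock.uniform_lopatinski_condition_iff[OF orthogonal[OF ell0]]
    by (auto simp: A_def B_def)
qed

end
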